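(* There exists a reaction diffusion system $$\frac{\partial u_i}{\partial t}=d_i\,\Delta u_i+f_i(u),\qquad i=1,\ldots,n,$$ on a smooth domain $\Omega\subseteq\mathbb{R}^m$ under Neumann boundary conditions, where $d_i>0$ and $f_i:\mathbb{R}^n\to\mathbb{R}$ is a $C^2$ function for $i=1,\ldots,n$, such that: (1) for every $u\in\mathbb{R}^n$ and every $i\neq j$, $\dfrac{\partial f_i}{\partial u_j}(u)>0$; (2) every solution of the system of ordinary differential equations $\dfrac{du_i}{dt}=f_i(u)$, $i=1,\ldots,n$, on $\mathbb{R}^n$ converges, as $t\to\infty$, towards one of only three equilibria; but (3) the set of nonhomogeneous equilibria of the reaction diffusion system has the cardinality of the continuum.
   Context: The state space of the reaction diffusion system is $C(\Omega,\mathbb{R}^n)$. An equilibrium of the reaction diffusion system is a time-independent solution, i.e. a function $u=(u_1,\ldots,u_n)$ on $\overline{\Omega}$ satisfying $d_i\Delta u_i+f_i(u)=0$ in $\Omega$ together with the Neumann boundary conditions $\partial u_i/\partial\nu=0$ on $\partial\Omega$, $i=1,\ldots,n$ (where $\nu$ is the outward normal). An equilibrium is called nonhomogeneous if it is not constant in space. An equilibrium of the ordinary differential equation is a zero of $f=(f_1,\ldots,f_n)$. *)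

theory Defs
  imports "HOL-Analysis.Analysis" "HOL-Library.Equipollence"
begin

text \<open>
  The dimensions \<open>n\<close> and \<open>m\<close> are quantified inside the theorem, so \<open>\<real>^m\<close> is taken to be the
  topological space \<open>Euclidean_space m\<close>: the sequences \<open>nat \<Rightarrow> real\<close> vanishing from index \<open>m\<close> on.
  Coordinates are numbered from \<open>0\<close> to \<open>m - 1\<close>.
\<close>

abbreviation Rn :: "nat \<Rightarrow> (nat \<Rightarrow> real) set" where
  "Rn n \<equiv> topspace (Euclidean_space n)"

definition bounded_in :: "nat \<Rightarrow> (nat \<Rightarrow> real) set \<Rightarrow> bool" where
  "bounded_in m S \<longleftrightarrow> S \<subseteq> Rn m \<and> (\<exists>B. \<forall>x\<in>S. sqrt (\<Sum>j<m. (x j)\<^sup>2) \<le> B)"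

text \<open>For \<open>j < m\<close> and \<open>x \<in> \<real>^m\<close> the line \<open>t \<mapsto> x(j := t)\<close> stays inside \<open>\<real>^m\<close>.\<close>

definition partially_differentiable :: "nat \<Rightarrow> ((nat \<Rightarrow> real) \<Rightarrow> real) \<Rightarrow> (nat \<Rightarrow> real) \<Rightarrow> bool" where
  "partially_differentiable j g x \<longleftrightarrow> (\<lambda>t. g (x(j := t))) field_differentiable (at (x j))"

definition partial_deriv :: "nat \<Rightarrow> ((nat \<Rightarrow> real) \<Rightarrow> real) \<Rightarrow> (nat \<Rightarrow> real) \<Rightarrow> real" where
  "partial_deriv j g x = deriv (\<lambda>t. g (x(j := t))) (x j)"

definition continuous_in :: "nat \<Rightarrow> (nat \<Rightarrow> real) set \<Rightarrow> ((nat \<Rightarrow> real) \<Rightarrow> real) \<Rightarrow> bool" where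
  "continuous_in m S g \<longleftrightarrow> continuous_map (subtopology (Euclidean_space m) S) euclideanreal g"

text \<open>\<open>C_k m k S g\<close>: \<open>g\<close> is of class \<open>C^k\<close> on \<open>S\<close>, where \<open>S\<close> is meant to be open in \<open>\<real>^m\<close>.\<close>

fun C_k :: "nat \<Rightarrow> nat \<Rightarrow> (nat \<Rightarrow> real) set \<Rightarrow> ((nat \<Rightarrow> real) \<Rightarrow> real) \<Rightarrow> bool" where
  "C_k m 0 S g \<longleftrightarrow> continuous_in m S g"
| "C_k m (Suc k) S g \<longleftrightarrow> continuous_in m S g \<and>
     (\<forall>j<m. (\<forall>x\<in>S. partially_differentiable j g x) \<and> C_k m k S (partial_deriv j g))"

definition laplacian :: "nat \<Rightarrow> ((nat \<Rightarrow> real) \<Rightarrow> real) \<Rightarrow> (nat \<Rightarrow> real) \<Rightarrow> real" where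
  "laplacian m g x = (\<Sum>j<m. partial_deriv j (partial_deriv j g) x)"

text \<open>
  A smooth boundary is described by local defining functions: near the boundary point \<open>x\<close> the set
  \<open>\<Omega>\<close> is \<open>{\<rho> < 0}\<close> with \<open>\<rho>\<close> smooth and \<open>\<nabla>\<rho>\<close> nowhere zero. By the implicit function theorem this
  means that \<open>\<Omega>\<close> is locally the region on one side of a smooth graph.
\<close>

definition local_defining ::
    "nat \<Rightarrow> (nat \<Rightarrow> real) set \<Rightarrow> (nat \<Rightarrow> real) \<Rightarrow> (nat \<Rightarrow> real) set \<Rightarrow> ((nat \<Rightarrow> real) \<Rightarrow> real) \<Rightarrow> bool" where
  "local_defining m \<Omega> x U \<rho> \<longleftrightarrow>
     openin (Euclidean_space m) U \<and> x \<in> U \<and>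
     (\<forall>k. C_k m k U \<rho>) \<and>
     (\<forall>y\<in>U. \<exists>j<m. partial_deriv j \<rho> y \<noteq> 0) \<and>
     \<Omega> \<inter> U = {y \<in> U. \<rho> y < 0}"

definition smooth_bounded_domain :: "nat \<Rightarrow> (nat \<Rightarrow> real) set \<Rightarrow> bool" where
  "smooth_bounded_domain m \<Omega> \<longleftrightarrow>
     openin (Euclidean_space m) \<Omega> \<and> connectedin (Euclidean_space m) \<Omega> \<and> \<Omega> \<noteq> {} \<and>
     bounded_in m \<Omega> \<and>
     (\<forall>x \<in> Euclidean_space m frontier_of \<Omega>. \<exists>U \<rho>. local_defining m \<Omega> x U \<rho>)"

text \<open>
  The outward unit normal at a boundary point, \<open>\<nabla>\<rho> / |\<nabla>\<rho>|\<close>. It does not depend on the choice of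
  \<open>\<rho>\<close>, and it exists at every boundary point of a smooth domain.
\<close>

definition outward_normal ::
    "nat \<Rightarrow> (nat \<Rightarrow> real) set \<Rightarrow> (nat \<Rightarrow> real) \<Rightarrow> (nat \<Rightarrow> real) \<Rightarrow> bool" where
  "outward_normal m \<Omega> x \<nu> \<longleftrightarrow> \<nu> \<in> Rn m \<and>
     (\<exists>U \<rho>. local_defining m \<Omega> x U \<rho> \<and>
        (\<forall>j<m. \<nu> j = partial_deriv j \<rho> x / sqrt (\<Sum>l<m. (partial_deriv l \<rho> x)\<^sup>2)))"

text \<open>
  The normal derivative at a boundary point is one-sided, since \<open>g\<close> is only meaningful on the
  closure of \<open>\<Omega>\<close>; for small \<open>h > 0\<close> the point \<open>x - h \<nu>\<close> lies in \<open>\<Omega>\<close>.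
\<close>

definition has_normal_deriv ::
    "((nat \<Rightarrow> real) \<Rightarrow> real) \<Rightarrow> real \<Rightarrow> (nat \<Rightarrow> real) \<Rightarrow> (nat \<Rightarrow> real) \<Rightarrow> bool" where
  "has_normal_deriv g D x \<nu> \<longleftrightarrow>
     ((\<lambda>h. (g x - g (\<lambda>j. x j - h * \<nu> j)) / h) \<longlongrightarrow> D) (at_right 0)"

definition neumann :: "nat \<Rightarrow> (nat \<Rightarrow> real) set \<Rightarrow> ((nat \<Rightarrow> real) \<Rightarrow> real) \<Rightarrow> bool" where
  "neumann m \<Omega> g \<longleftrightarrow>
     (\<forall>x \<in> Euclidean_space m frontier_of \<Omega>. \<forall>\<nu>. outward_normal m \<Omega> x \<nu> \<longrightarrow> has_normal_deriv g 0 x \<nu>)"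

text \<open>Class \<open>C^1\<close> up to the boundary: \<open>g\<close> and its first partials extend continuously to the closure.\<close>

definition C1_closure :: "nat \<Rightarrow> (nat \<Rightarrow> real) set \<Rightarrow> ((nat \<Rightarrow> real) \<Rightarrow> real) \<Rightarrow> bool" where
  "C1_closure m \<Omega> g \<longleftrightarrow>
     C_k m 1 \<Omega> g \<and> continuous_in m (Euclidean_space m closure_of \<Omega>) g \<and>
     (\<forall>j<m. \<exists>G. continuous_in m (Euclidean_space m closure_of \<Omega>) G \<and>
                (\<forall>x\<in>\<Omega>. G x = partial_deriv j g x))"

text \<open>
  Equilibria of \<open>\<partial>u\<^sub>i/\<partial>t = d\<^sub>i \<Delta>u\<^sub>i + f\<^sub>i(u)\<close> under Neumann conditions, as classical solutions. They are
  functions on the closure of \<open>\<Omega>\<close>; using the extensional function space makes every such function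
  be represented exactly once, so that counting them is meaningful.
\<close>

definition rd_equilibria ::
    "nat \<Rightarrow> nat \<Rightarrow> (nat \<Rightarrow> real) \<Rightarrow> (nat \<Rightarrow> (nat \<Rightarrow> real) \<Rightarrow> real) \<Rightarrow> (nat \<Rightarrow> real) set
      \<Rightarrow> ((nat \<Rightarrow> real) \<Rightarrow> (nat \<Rightarrow> real)) set" where
  "rd_equilibria n m d f \<Omega> =
     {u \<in> (Euclidean_space m closure_of \<Omega>) \<rightarrow>\<^sub>E Rn n.
        \<forall>i<n. C_k m 2 \<Omega> (\<lambda>x. u x i) \<and> C1_closure m \<Omega> (\<lambda>x. u x i) \<and>
              (\<forall>x\<in>\<Omega>. d i * laplacian m (\<lambda>x. u x i) x + f i (u x) = 0) \<and>
              neumann m \<Omega> (\<lambda>x. u x i)}"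

definition nonhomogeneous_equilibria ::
    "nat \<Rightarrow> nat \<Rightarrow> (nat \<Rightarrow> real) \<Rightarrow> (nat \<Rightarrow> (nat \<Rightarrow> real) \<Rightarrow> real) \<Rightarrow> (nat \<Rightarrow> real) set
      \<Rightarrow> ((nat \<Rightarrow> real) \<Rightarrow> (nat \<Rightarrow> real)) set" where
  "nonhomogeneous_equilibria n m d f \<Omega> =
     {u \<in> rd_equilibria n m d f \<Omega>. \<not> u constant_on (Euclidean_space m closure_of \<Omega>)}"

definition ode_equilibria :: "nat \<Rightarrow> (nat \<Rightarrow> (nat \<Rightarrow> real) \<Rightarrow> real) \<Rightarrow> (nat \<Rightarrow> real) set" where
  "ode_equilibria n f = {e \<in> Rn n. \<forall>i<n. f i e = 0}"

definition ode_solution :: "nat \<Rightarrow> (nat \<Rightarrow> (nat \<Rightarrow> real) \<Rightarrow> real) \<Rightarrow> (real \<Rightarrow> nat \<Rightarrow> real) \<Rightarrow> bool" where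
  "ode_solution n f u \<longleftrightarrow>
     (\<forall>t\<ge>0. u t \<in> Rn n \<and>
        (\<forall>i<n. ((\<lambda>s. u s i) has_real_derivative f i (u t)) (at t within {0..})))"

text \<open>
  That every solution converges as \<open>t \<rightarrow> \<infinity>\<close> includes that no solution blows up in finite time. For
  locally Lipschitz \<open>f\<close> solutions are unique, so this is the first conjunct.
\<close>

definition all_ode_solutions_converge_into ::
    "nat \<Rightarrow> (nat \<Rightarrow> (nat \<Rightarrow> real) \<Rightarrow> real) \<Rightarrow> (nat \<Rightarrow> real) set \<Rightarrow> bool" where
  "all_ode_solutions_converge_into n f E \<longleftrightarrow>
     (\<forall>a\<in>Rn n. \<exists>u. ode_solution n f u \<and> u 0 = a) \<and>
     (\<forall>u. ode_solution n f u \<longrightarrow> (\<exists>e\<in>E. limitin (Euclidean_space n) u e at_top))"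

end

theory Submission
  imports Defs
begin

text \<open>
  A scalar reaction \<open>G\<close> with exactly three zeros can nevertheless be linear near its middle zero:
  take \<open>G s = s\<close> on \<open>[-1, 1]\<close>. Then \<open>w'' + G w = 0\<close> on \<open>(0, pi)\<close> with Neumann conditions is
  solved by \<open>w x = a * cos x\<close> for every amplitude \<open>\<bar>a\<bar> \<le> 1\<close>, because \<open>1\<close> is an eigenvalue of the
  negative Neumann Laplacian on \<open>(0, pi)\<close>. So a continuum of nonhomogeneous equilibria exists
  although \<open>u' = G u\<close> has only three rest points (\<open>cosine_profile_equilibrium\<close>).

  The scalar example is lifted to a strictly cooperative system of \<open>n\<close> equations by
  \<open>f\<^sub>i u = G (mean u) + c (mean u - u\<^sub>i)\<close>. The mean of a solution satisfies the scalar equation and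
  the deviations \<open>u\<^sub>i - mean u\<close> decay like \<open>exp (- c t)\<close>, so every solution converges to a constant
  vector \<open>(z, ..., z)\<close> with \<open>G z = 0\<close> (\<open>reaction_solution_converges\<close>). The off-diagonal derivatives are
  \<open>(G' + c) / n\<close>, which is positive as soon as \<open>G' > - c\<close> (\<open>reaction_partial_deriv_pos\<close>). This is why
  \<open>G\<close> must not decrease faster than linearly, and a polynomial such as \<open>s - s\<^sup>3\<close> would not do; the
  function \<open>bistable\<close> has zeros \<open>-2, 0, 2\<close> and slopes in \<open>[-15, 1]\<close>, and \<open>c = 16\<close>.

  For the scalar equation, global existence comes from a contraction in an exponentially weighted
  norm (\<open>lipschitz_scalar_ode_solvable\<close>) and convergence from monotonicity of scalar solutions
  (\<open>dissipative_scalar_ode_converges\<close>). The amplitudes show that the nonhomogeneous equilibria are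
  at least as numerous as the reals; they are not more numerous since continuous functions on a
  separable space are determined by countably much data (\<open>rd_equilibria_lepoll_reals\<close>).
\<close>

section \<open>Functions of class \<open>C\<^sup>k\<close> on open subsets of Euclidean space\<close>

lemma Euclidean_space_eq_top_of_set: "Euclidean_space m = top_of_set {x. \<forall>i\<ge>m. x i = 0}"
  by (simp add: Euclidean_space_def euclidean_product_topology)

lemma continuous_in_iff_continuous_on:
  assumes "S \<subseteq> Rn m"
  shows "continuous_in m S g \<longleftrightarrow> continuous_on S g"
proof -
  have "subtopology (Euclidean_space m) S = top_of_set S"
    using assms
    by (simp add: Euclidean_space_eq_top_of_set subtopology_subtopology inf.absorb2)
  then show ?thesis by (simp add: continuous_in_def)
qed

lemma openin_line_neighbourhood:
  assumes "openin (Euclidean_space m) S" "x \<in> S" "j < m"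
  shows "\<forall>\<^sub>F t in nhds (x j). x(j := t) \<in> S"
proof -
  obtain T where T: "open T" "S = {x. \<forall>i\<ge>m. x i = 0} \<inter> T"
    using assms(1) by (auto simp: Euclidean_space_eq_top_of_set openin_open)
  have "continuous_on UNIV (\<lambda>t::real. x(j := t))"
  proof (rule continuous_on_coordinatewise_then_product)
    fix i
    show "continuous_on UNIV (\<lambda>t. (x(j := t)) i)"
      by (cases "i = j") (auto intro: continuous_intros)
  qed
  then have "open ((\<lambda>t. x(j := t)) -` T)"
    using T(1) open_vimage by blast
  moreover have "x j \<in> (\<lambda>t. x(j := t)) -` T"
    using assms(2) T(2) by simp
  ultimately have "\<forall>\<^sub>F t in nhds (x j). t \<in> (\<lambda>t. x(j := t)) -` T"
    by (rule eventually_nhds_in_open)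
  then show ?thesis
    using assms T(2) by (auto elim!: eventually_mono)
qed

text \<open>
  Partial derivatives only look at a small piece of a coordinate line, so on an open set they do
  not see how a function is continued outside. Equilibria are undefined off the closure of the
  domain; this is what allows computing with an explicit formula in their place.
\<close>

lemma partial_deriv_cong_open:
  assumes "openin (Euclidean_space m) S" "x \<in> S" "j < m" "\<And>y. y \<in> S \<Longrightarrow> g y = h y"
  shows "partial_deriv j g x = partial_deriv j h x"
    and "partially_differentiable j g x \<longleftrightarrow> partially_differentiable j h x"
proof -
  have ev: "\<forall>\<^sub>F t in nhds (x j). g (x(j := t)) = h (x(j := t))"
    using openin_line_neighbourhood[OF assms(1-3)] assms(4) by (auto elim: eventually_mono)
  show "partial_deriv j g x = partial_deriv j h x"
    unfolding partial_deriv_def using ev by (intro deriv_cong_ev) auto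
  show "partially_differentiable j g x \<longleftrightarrow> partially_differentiable j h x"
    unfolding partially_differentiable_def field_differentiable_def
    using DERIV_cong_ev[OF refl ev refl] by blast
qed

lemma C_k_cong_open:
  assumes "openin (Euclidean_space m) S" "\<And>y. y \<in> S \<Longrightarrow> g y = h y"
  shows "C_k m k S g \<longleftrightarrow> C_k m k S h"
proof -
  have S: "S \<subseteq> Rn m" using assms(1) openin_subset by blast
  have cont: "continuous_in m S g \<longleftrightarrow> continuous_in m S h" if "\<And>y. y \<in> S \<Longrightarrow> g y = h y" for g h
    unfolding continuous_in_iff_continuous_on[OF S] by (rule continuous_on_cong[OF refl that])
  show ?thesis using assms(2)
  proof (induction k arbitrary: g h)
    case 0
    then show ?case using cont[OF 0] by simp
  next
    case (Suc k)
    have "C_k m k S (partial_deriv j g) \<longleftrightarrow> C_k m k S (partial_deriv j h)" if "j < m" for j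
      using partial_deriv_cong_open(1)[OF assms(1) _ that Suc.prems] by (intro Suc.IH)
    then show ?case
      using cont[OF Suc.prems] partial_deriv_cong_open(2)[OF assms(1) _ _ Suc.prems]
      by (auto simp: Ball_def)
  qed
qed

text \<open>
  The induction needs the congruence lemma: where a summand fails to be partially differentiable,
  the partial derivative of the sum is unrelated to the sum of the partial derivatives.
\<close>

lemma C_k_add:
  assumes "openin (Euclidean_space m) S" "C_k m k S g" "C_k m k S h"
  shows "C_k m k S (\<lambda>x. g x + h x)"
  using assms(2,3)
proof (induction k arbitrary: g h)
  case 0
  have S: "S \<subseteq> Rn m" using assms(1) openin_subset by blast
  show ?case
    using 0 by (simp add: continuous_in_iff_continuous_on[OF S] continuous_on_add)
next
  case (Suc k)
  have S: "S \<subseteq> Rn m" using assms(1) openin_subset by blast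
  have c: "continuous_in m S (\<lambda>x. g x + h x)"
    using Suc.prems by (simp add: continuous_in_iff_continuous_on[OF S] continuous_on_add)
  have "(\<forall>x\<in>S. partially_differentiable j (\<lambda>x. g x + h x) x)
      \<and> C_k m k S (partial_deriv j (\<lambda>x. g x + h x))" if j: "j < m" for j
  proof
    have d: "partially_differentiable j g x" "partially_differentiable j h x" if "x \<in> S" for x
      using Suc.prems j that by auto
    then show "\<forall>x\<in>S. partially_differentiable j (\<lambda>x. g x + h x) x"
      unfolding partially_differentiable_def by (auto intro: field_differentiable_add)
    have "partial_deriv j (\<lambda>x. g x + h x) x = partial_deriv j g x + partial_deriv j h x"
      if "x \<in> S" for x
      using d[OF that] unfolding partially_differentiable_def partial_deriv_def by simp
    moreover have "C_k m k S (\<lambda>x. partial_deriv j g x + partial_deriv j h x)"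
      using Suc.prems j by (intro Suc.IH) auto
    ultimately show "C_k m k S (partial_deriv j (\<lambda>x. g x + h x))"
      using C_k_cong_open[OF assms(1)] by (metis (no_types, lifting))
  qed
  then show ?case using c by simp
qed

lemma has_partial_deriv_ridge:
  fixes a :: "nat \<Rightarrow> real"
  assumes "(\<phi> has_real_derivative D) (at (\<Sum>l<m. a l * x l))" "j < m"
  shows "((\<lambda>t. \<phi> (\<Sum>l<m. a l * (x(j := t)) l)) has_real_derivative D * a j) (at (x j))"
proof -
  have "((\<lambda>t. a l * (x(j := t)) l) has_real_derivative (if l = j then a l else 0)) (at (x j))" for l
    by (cases "l = j") (auto intro!: derivative_eq_intros)
  then have "((\<lambda>t. \<Sum>l<m. a l * (x(j := t)) l) has_real_derivative
      (\<Sum>l<m. if l = j then a l else 0)) (at (x j))"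
    by (intro DERIV_sum)
  then have "((\<lambda>t. \<Sum>l<m. a l * (x(j := t)) l) has_real_derivative a j) (at (x j))"
    using assms(2) by simp
  from DERIV_chain2[OF _ this, of \<phi> D] show ?thesis
    using assms(1) by simp
qed

text \<open>
  Every function whose smoothness is needed is a sum of ridge functions, that is, of functions of
  one variable composed with a linear form. Each partial derivative of a ridge function is a
  multiple of a ridge function with the same linear form, on the whole space, so the induction
  never leaves this class. The sequence \<open>\<phi>\<close> lists the successive derivatives of the profile.
\<close>

lemma C_k_ridge:
  fixes a :: "nat \<Rightarrow> real" and \<phi> :: "nat \<Rightarrow> real \<Rightarrow> real"
  assumes "S \<subseteq> Rn m" "\<And>i t. i < k \<Longrightarrow> (\<phi> i has_real_derivative \<phi> (Suc i) t) (at t)"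
    and "continuous_on UNIV (\<phi> k)"
  shows "C_k m k S (\<lambda>x. c * \<phi> 0 (\<Sum>l<m. a l * x l))"
  using assms(2,3)
proof (induction k arbitrary: \<phi> c)
  have cont: "continuous_in m S (\<lambda>x. c * \<phi> (\<Sum>l<m. a l * x l))"
    if "continuous_on UNIV \<phi>" for c :: real and \<phi> :: "real \<Rightarrow> real"
  proof -
    have "continuous_on S (\<lambda>x. \<Sum>l<m. a l * x l)"
      by (intro continuous_intros continuous_on_product_coordinates)
        (auto intro: continuous_on_subset[OF continuous_on_product_coordinates])
    then have "continuous_on S (\<lambda>x. \<phi> (\<Sum>l<m. a l * x l))"
      using that continuous_on_compose2 by blast
    then show ?thesis
      by (simp add: continuous_in_iff_continuous_on[OF assms(1)] continuous_on_mult_left)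
  qed
  {
    case 0
    then show ?case using cont by simp
  next
    case (Suc k)
    have d: "((\<lambda>t. c * \<phi> 0 (\<Sum>l<m. a l * (x(j := t)) l)) has_real_derivative
        (c * a j) * \<phi> 1 (\<Sum>l<m. a l * x l)) (at (x j))" if "j < m" for x j
      using DERIV_cmult[OF has_partial_deriv_ridge[OF Suc.prems(1)[of 0] that], of c]
      by (simp add: ac_simps)
    have "continuous_on UNIV (\<phi> 0)"
      using Suc.prems(1)[of 0] by (intro continuous_at_imp_continuous_on) (auto intro: DERIV_isCont)
    moreover have "partial_deriv j (\<lambda>x. c * \<phi> 0 (\<Sum>l<m. a l * x l))
        = (\<lambda>x. (c * a j) * \<phi> 1 (\<Sum>l<m. a l * x l))" if "j < m" for j
      using DERIV_imp_deriv[OF d[OF that]] by (intro ext) (simp only: partial_deriv_def)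
    moreover have "C_k m k S (\<lambda>x. (c * a j) * \<phi> 1 (\<Sum>l<m. a l * x l))" for j
      using Suc.IH[of "\<lambda>i. \<phi> (Suc i)" "c * a j"] Suc.prems by simp
    moreover have "partially_differentiable j (\<lambda>x. c * \<phi> 0 (\<Sum>l<m. a l * x l)) x" if "j < m" for j x
      using d[OF that] unfolding partially_differentiable_def field_differentiable_def by blast
    ultimately show ?case
      using cont by simp
  }
qed

section \<open>Scalar autonomous differential equations\<close>

text \<open>
  Growth like \<open>exp (\<kappa> r)\<close> survives integration and gains the factor \<open>1 / \<kappa>\<close>. That factor is
  what makes the Picard operator a contraction in a weighted norm.
\<close>

lemma integral_exp_weight_bound:
  fixes h :: "real \<Rightarrow> real"
  assumes "continuous_on UNIV h" "\<kappa> > 0" "0 \<le> t" "\<And>r. 0 \<le> r \<Longrightarrow> \<bar>h r\<bar> \<le> M * exp (\<kappa> * r)"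
  shows "\<bar>integral {0..t} h\<bar> \<le> M / \<kappa> * exp (\<kappa> * t)"
proof -
  have M: "0 \<le> M" using assms(4)[of 0] by simp
  have I: "((\<lambda>r. M * exp (\<kappa> * r)) has_integral M / \<kappa> * exp (\<kappa> * t) - M / \<kappa> * exp (\<kappa> * 0)) {0..t}"
    using assms(2,3)
    by (intro fundamental_theorem_of_calculus)
      (auto intro!: derivative_eq_intros simp flip: has_real_derivative_iff_has_vector_derivative)
  have "norm (integral {0..t} h) \<le> integral {0..t} (\<lambda>r. M * exp (\<kappa> * r))"
    using assms(4) continuous_on_subset[OF assms(1)] I
    by (intro integral_norm_bound_integral integrable_continuous_real)
      (auto intro!: continuous_intros)
  also have "\<dots> = M / \<kappa> * exp (\<kappa> * t) - M / \<kappa>"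
    using integral_unique[OF I] by simp
  also have "\<dots> \<le> M / \<kappa> * exp (\<kappa> * t)"
    using M assms(2) by simp
  finally show ?thesis by simp
qed

lemma indefinite_integral_has_derivative_halfline:
  fixes h :: "real \<Rightarrow> real"
  assumes "continuous_on UNIV h" "0 \<le> t"
  shows "((\<lambda>t. integral {0..t} h) has_real_derivative h t) (at t within {0..})"
proof -
  have "((\<lambda>t. integral {0..t} h) has_real_derivative h t) (at t within {0..t+1})"
    using assms by (intro integral_has_real_derivative) (auto intro: continuous_on_subset)
  moreover have "at t within {0..t+1} = at t within {0..}"
    by (rule at_within_nhd[of _ "{..<t+1}"]) auto
  ultimately show ?thesis by simp
qed

text \<open>
  Banach's fixed point theorem gives the solution on all of \<open>[0, \<infinity>)\<close> at once if distances at
  time \<open>t\<close> are weighted with \<open>exp (- 2 L t)\<close>. Writing \<open>s t = a + exp (2 L t) v t\<close> turns the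
  weighted norm of \<open>s - a\<close> into the sup norm of \<open>v\<close>, and the integral equation into a fixed point
  equation for \<open>v\<close> among bounded continuous functions, with contraction factor \<open>1 / 2\<close>.
\<close>

lemma lipschitz_scalar_ode_solvable:
  fixes g :: "real \<Rightarrow> real"
  assumes L: "L > 0" and lip: "\<And>x y. \<bar>g x - g y\<bar> \<le> L * \<bar>x - y\<bar>"
  obtains s where "s 0 = a" "\<And>t. 0 \<le> t \<Longrightarrow> (s has_real_derivative g (s t)) (at t within {0..})"
proof -
  define h where "h v r = g (a + exp (2 * L * r) * v r)" for v :: "real \<Rightarrow> real" and r
  (* max 0 t continues the integral equation constantly to negative times, so that v lives on
     the whole line *)
  define F where "F v t = exp (- 2 * L * max 0 t) * integral {0..max 0 t} (h v)" for v t
  have "L-lipschitz_on UNIV g"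
    using L lip by (intro lipschitz_onI) (auto simp: dist_real_def)
  then have g: "continuous_on UNIV g"
    by (rule lipschitz_on_continuous_on)
  have h: "continuous_on UNIV (h v)" if "continuous_on UNIV v" for v
    unfolding h_def using that
    by (intro continuous_on_compose2[OF g] continuous_intros) auto
  have exp_cancel: "exp (- 2 * L * t) * exp (2 * L * t) = 1" for t
    by (simp flip: exp_add)
  have bcont: "F v \<in> bcontfun" if v: "continuous_on UNIV v" "bounded (range v)" for v
  proof -
    have "continuous_on {0..} (\<lambda>t. integral {0..t} (h v))"
      by (rule DERIV_continuous_on, rule indefinite_integral_has_derivative_halfline)
        (use h v in auto)
    then have "continuous_on UNIV (F v)"
      unfolding F_def
      by (intro continuous_intros continuous_on_compose2[of "{0..}" "\<lambda>t. integral {0..t} (h v)" UNIV "max 0"])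
        auto
    moreover obtain B where B: "\<And>r. \<bar>v r\<bar> \<le> B" 
      using v(2) by (auto simp: bounded_iff)
    have "\<bar>F v t\<bar> \<le> (\<bar>g a\<bar> + L * B) / (2 * L)" for t
    proof -
      have "\<bar>h v r\<bar> \<le> (\<bar>g a\<bar> + L * B) * exp (2 * L * r)" if "0 \<le> r" for r
      proof -
        have "\<bar>h v r\<bar> \<le> \<bar>g a\<bar> + \<bar>h v r - g a\<bar>" by simp
        also have "\<bar>h v r - g a\<bar> \<le> L * \<bar>exp (2 * L * r) * v r\<bar>"
          using lip[of "a + exp (2 * L * r) * v r" a] by (simp add: h_def)
        also have "\<dots> \<le> L * (exp (2 * L * r) * B)"
          using L B[of r] by (simp add: abs_mult mult_left_mono)
        also have "\<bar>g a\<bar> \<le> \<bar>g a\<bar> * exp (2 * L * r)"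
          using L that by (simp add: mult_le_cancel_left1)
        finally show ?thesis by (simp add: algebra_simps)
      qed
      then have "\<bar>integral {0..max 0 t} (h v)\<bar> \<le> (\<bar>g a\<bar> + L * B) / (2 * L) * exp (2 * L * max 0 t)"
        using L h v(1) by (intro integral_exp_weight_bound) auto
      then have "\<bar>F v t\<bar> \<le> exp (- 2 * L * max 0 t) * ((\<bar>g a\<bar> + L * B) / (2 * L) * exp (2 * L * max 0 t))"
        unfolding F_def abs_mult abs_exp_cancel by (rule mult_left_mono) simp
      also have "\<dots> = (\<bar>g a\<bar> + L * B) / (2 * L)"
        using exp_cancel[of "max 0 t"] by (simp add: field_simps)
      finally show ?thesis .
    qed
    ultimately show ?thesis
      unfolding bcontfun_def bounded_iff by auto
  qed
  define \<Phi> where "\<Phi> v = Bcontfun (F (apply_bcontfun v))" for v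
  have \<Phi>: "apply_bcontfun (\<Phi> v) = F (apply_bcontfun v)" for v
    unfolding \<Phi>_def by (rule Bcontfun_inverse, rule bcont) auto
  have "dist (\<Phi> v) (\<Phi> w) \<le> 1 / 2 * dist v w" for v w
  proof (rule dist_bound)
    fix t :: real
    let ?t = "max 0 t"
    have cv: "continuous_on UNIV (h (apply_bcontfun v))" and cw: "continuous_on UNIV (h (apply_bcontfun w))"
      by (auto intro: h)
    have "\<bar>h v r - h w r\<bar> \<le> L * dist v w * exp (2 * L * r)" if "0 \<le> r" for r
    proof -
      have "\<bar>h v r - h w r\<bar> \<le> L * \<bar>exp (2 * L * r) * v r - exp (2 * L * r) * w r\<bar>"
        using lip[of "a + exp (2 * L * r) * v r" "a + exp (2 * L * r) * w r"] by (simp add: h_def)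
      also have "\<dots> = L * exp (2 * L * r) * dist (v r) (w r)"
        by (simp add: dist_real_def abs_mult flip: right_diff_distrib)
      also have "\<dots> \<le> L * exp (2 * L * r) * dist v w"
        using L dist_bounded[of v r w] by (intro mult_left_mono) auto
      finally show ?thesis by (simp add: ac_simps)
    qed
    then have "\<bar>integral {0..?t} (\<lambda>r. h v r - h w r)\<bar> \<le> L * dist v w / (2 * L) * exp (2 * L * ?t)"
      using L cv cw by (intro integral_exp_weight_bound) (auto intro: continuous_intros)
    moreover have "integral {0..?t} (\<lambda>r. h v r - h w r) = integral {0..?t} (h v) - integral {0..?t} (h w)"
      using cv cw
      by (intro Henstock_Kurzweil_Integration.integral_diff integrable_continuous_real)
        (auto intro: continuous_on_subset)
    ultimately have "exp (- 2 * L * ?t) * \<bar>integral {0..?t} (h v) - integral {0..?t} (h w)\<bar>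
        \<le> exp (- 2 * L * ?t) * (L * dist v w / (2 * L) * exp (2 * L * ?t))"
      by (intro mult_left_mono) auto
    also have "\<dots> = 1 / 2 * dist v w"
      using L exp_cancel[of ?t] by (simp add: field_simps)
    also have "exp (- 2 * L * ?t) * \<bar>integral {0..?t} (h v) - integral {0..?t} (h w)\<bar> = dist (\<Phi> v t) (\<Phi> w t)"
      by (simp add: \<Phi> F_def dist_real_def abs_mult flip: right_diff_distrib)
    finally show "dist (\<Phi> v t) (\<Phi> w t) \<le> 1 / 2 * dist v w" .
  qed
  then obtain v where "\<Phi> v = v"
    using banach_fix_type[of "1/2" \<Phi>] by auto
  then have v: "v t = exp (- 2 * L * max 0 t) * integral {0..max 0 t} (h v)" for t
    using \<Phi>[of v] F_def[of v t] by simp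
  define s where "s t = a + exp (2 * L * t) * v t" for t
  have s: "s t = a + integral {0..t} (h v)" if "0 \<le> t" for t
    using v[of t] that exp_cancel[of t] by (simp add: s_def ac_simps flip: mult.assoc)
  have hs: "h v t = g (s t)" for t by (simp add: h_def s_def)
  show ?thesis
  proof
    show "s 0 = a" using s[of 0] by simp
    fix t :: real assume t: "0 \<le> t"
    have "((\<lambda>t. a + integral {0..t} (h v)) has_real_derivative g (s t)) (at t within {0..})"
      using DERIV_add[OF DERIV_const indefinite_integral_has_derivative_halfline[OF h[of "apply_bcontfun v"] t]]
      by (simp add: hs)
    then show "(s has_real_derivative g (s t)) (at t within {0..})"
      by (rule has_field_derivative_transform_within[where d = 1]) (use s t in auto)
  qed
qed

lemma halfline_solution_properties:
  assumes "\<And>t. 0 \<le> t \<Longrightarrow> (s has_real_derivative s' t) (at t within {0..})"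
  shows "continuous_on {0..} s"
    and "\<And>t. 0 < t \<Longrightarrow> (s has_real_derivative s' t) (at t)"
proof -
  show "continuous_on {0..} s"
    using assms by (rule DERIV_continuous_on) auto
  fix t :: real assume "0 < t"
  then have "at t within {0..} = at t"
    by (intro at_within_nhd[of _ "{0<..}"]) auto
  then show "(s has_real_derivative s' t) (at t)"
    using assms[of t] \<open>0 < t\<close> by simp
qed

text \<open>
  Forward uniqueness at a rest point: by the Lipschitz bound the squared distance to the rest point
  grows at most at rate \<open>2 L\<close>, and it starts at \<open>0\<close>.
\<close>

lemma scalar_ode_stays_at_zero:
  fixes g :: "real \<Rightarrow> real"
  assumes lip: "\<And>x y. \<bar>g x - g y\<bar> \<le> L * \<bar>x - y\<bar>"
    and sol: "\<And>t. 0 \<le> t \<Longrightarrow> (s has_real_derivative g (s t)) (at t within {0..})"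
    and zero: "0 \<le> t0" "g (s t0) = 0" and "t0 \<le> t"
  shows "s t = s t0"
proof -
  define E where "E r = (s r - s t0)\<^sup>2 * exp (- 2 * L * r)" for r
  note props = halfline_solution_properties[OF sol, simplified]
  have "E t \<le> E t0"
  proof (rule DERIV_nonpos_imp_decreasing_open[OF \<open>t0 \<le> t\<close>])
    show "continuous_on {t0..t} E"
      unfolding E_def using zero
      by (intro continuous_intros continuous_on_subset[OF props(1)]) auto
    fix r assume "t0 < r" "r < t"
    have "(E has_real_derivative
        2 * ((s r - s t0) * g (s r) - L * (s r - s t0)\<^sup>2) * exp (- 2 * L * r)) (at r)"
      unfolding E_def using props(2)[of r] \<open>t0 < r\<close> zero(1)
      by (auto intro!: derivative_eq_intros simp: algebra_simps power2_eq_square)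
    moreover have "(s r - s t0) * g (s r) \<le> L * (s r - s t0)\<^sup>2"
    proof -
      have "(s r - s t0) * g (s r) \<le> \<bar>s r - s t0\<bar> * \<bar>g (s r) - g (s t0)\<bar>"
        using zero(2) by (metis abs_ge_self abs_mult diff_zero)
      also have "\<dots> \<le> \<bar>s r - s t0\<bar> * (L * \<bar>s r - s t0\<bar>)"
        by (intro mult_left_mono lip) auto
      finally show ?thesis by (simp add: power2_eq_square ac_simps flip: abs_mult)
    qed
    ultimately show "\<exists>y. DERIV E r :> y \<and> y \<le> 0"
      by (intro exI conjI) (assumption, simp add: mult_le_0_iff)
  qed
  then have "(s t - s t0)\<^sup>2 * exp (- 2 * L * t) \<le> 0" by (simp add: E_def)
  then show ?thesis by (simp add: mult_le_0_iff)
qed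

text \<open>
  The increments \<open>s (t + 1) - s t\<close> of a convergent solution tend to \<open>0\<close>, and by the mean value
  theorem each of them is a value \<open>g (s (z t))\<close> with \<open>z t > t\<close>.
\<close>

lemma scalar_ode_limit_is_zero:
  fixes g :: "real \<Rightarrow> real"
  assumes g: "isCont g l" 
    and sol: "\<And>t. 0 \<le> t \<Longrightarrow> (s has_real_derivative g (s t)) (at t within {0..})"
    and lim: "(s \<longlongrightarrow> l) at_top"
  shows "g l = 0"
proof -
  note props = halfline_solution_properties[OF sol, simplified]
  have "\<exists>z. t < z \<and> s (t + 1) - s t = g (s z)" if "0 < t" for t
    using MVT2[of t "t + 1" s "\<lambda>z. g (s z)"] props(2) that by auto
  then obtain z where z: "\<And>t. 0 < t \<Longrightarrow> t < z t \<and> s (t + 1) - s t = g (s (z t))"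
    by metis
  have "filterlim z at_top at_top"
    by (rule filterlim_at_top_mono[OF filterlim_ident])
      (use z in \<open>auto intro!: eventually_at_top_linorderI[of 1] less_imp_le\<close>)
  then have "((\<lambda>t. g (s (z t))) \<longlongrightarrow> g l) at_top"
    using isCont_tendsto_compose[OF g lim] by (rule filterlim_compose[rotated])
  moreover have "filterlim (\<lambda>t::real. 1 + t) at_top at_top"
    by (intro filterlim_tendsto_add_at_top[OF tendsto_const] filterlim_ident)
  then have "((\<lambda>t. s (1 + t) - s t) \<longlongrightarrow> l - l) at_top"
    by (intro tendsto_diff filterlim_compose[OF lim] lim)
  then have "((\<lambda>t. g (s (z t))) \<longlongrightarrow> l - l) at_top"
    by (rule Lim_transform_eventually)
      (use z in \<open>auto intro!: eventually_at_top_linorderI[of 1] simp: add.commute\<close>)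
  ultimately show ?thesis
    using tendsto_unique[OF trivial_limit_at_top_linorder] by fastforce
qed

lemma increasing_bounded_converges_at_top:
  fixes s :: "real \<Rightarrow> real"
  assumes mono: "\<And>r t. 0 \<le> r \<Longrightarrow> r \<le> t \<Longrightarrow> s r \<le> s t" and bd: "\<And>t. 0 \<le> t \<Longrightarrow> s t \<le> B"
  shows "\<exists>l. (s \<longlongrightarrow> l) at_top"
proof (rule exI)
  have bdd: "bdd_above (s ` {0..})" using bd by (auto simp: bdd_above_def)
  show "(s \<longlongrightarrow> Sup (s ` {0..})) at_top"
  proof (rule order_tendstoI)
    fix y assume "y < Sup (s ` {0..})"
    then obtain r where "0 \<le> r" "y < s r"
      using less_cSup_iff[OF _ bdd] by auto
    then show "\<forall>\<^sub>F t in at_top. y < s t"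
      using mono by (intro eventually_at_top_linorderI[of r]) (meson less_le_trans)
  next
    fix y assume "Sup (s ` {0..}) < y"
    then show "\<forall>\<^sub>F t in at_top. s t < y"
      using cSup_upper[OF imageI bdd] by (intro eventually_at_top_linorderI[of 0]) (meson atLeast_iff le_less_trans)
  qed
qed

lemma scalar_ode_converges_if_increasing:
  fixes g :: "real \<Rightarrow> real"
  assumes dissipative: "\<And>x. x > R \<Longrightarrow> g x \<le> 0"
    and sol: "\<And>t. 0 \<le> t \<Longrightarrow> (s has_real_derivative g (s t)) (at t within {0..})"
    and pos: "\<And>t. 0 \<le> t \<Longrightarrow> g (s t) > 0"
  shows "\<exists>l. (s \<longlongrightarrow> l) at_top"
proof -
  note props = halfline_solution_properties[OF sol, simplified]
  have "s r \<le> s t" if "0 \<le> r" "r \<le> t" for r t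
  proof (rule DERIV_nonneg_imp_increasing_open[OF \<open>r \<le> t\<close>])
    show "\<exists>y. DERIV s x :> y \<and> 0 \<le> y" if "r < x" for x
      using props(2)[of x] pos[of x] \<open>0 \<le> r\<close> that by (intro exI[of _ "g (s x)"]) simp
    show "continuous_on {r..t} s"
      by (rule continuous_on_subset[OF props(1)]) (use \<open>0 \<le> r\<close> in auto)
  qed
  moreover have "s t \<le> R" if "0 \<le> t" for t
    using dissipative[of "s t"] pos[OF that] by force
  ultimately show ?thesis
    by (rule increasing_bounded_converges_at_top)
qed

text \<open>
  A solution that meets a zero of \<open>g\<close> stays there. Any other solution never changes direction, so
  it is monotone, and it is bounded because it cannot move outwards beyond \<open>R\<close>. Decreasing
  solutions reduce to increasing ones under the reflection of the line.
\<close>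

lemma dissipative_scalar_ode_converges:
  fixes g :: "real \<Rightarrow> real"
  assumes lip: "\<And>x y. \<bar>g x - g y\<bar> \<le> L * \<bar>x - y\<bar>" and "L > 0"
    and dissipative: "\<And>x. x > R \<Longrightarrow> g x \<le> 0" "\<And>x. x < - R \<Longrightarrow> g x \<ge> 0"
    and sol: "\<And>t. 0 \<le> t \<Longrightarrow> (s has_real_derivative g (s t)) (at t within {0..})"
  obtains l where "g l = 0" "(s \<longlongrightarrow> l) at_top"
proof -
  have "L-lipschitz_on UNIV g"
    using \<open>L > 0\<close> lip by (intro lipschitz_onI) (auto simp: dist_real_def)
  then have g: "continuous_on UNIV g"
    by (rule lipschitz_on_continuous_on)
  have "\<exists>l. (s \<longlongrightarrow> l) at_top"
  proof (cases "\<exists>t0\<ge>0. g (s t0) = 0")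
    case True
    then obtain t0 where t0: "0 \<le> t0" "g (s t0) = 0" by blast
    have "(s \<longlongrightarrow> s t0) at_top"
      by (rule tendsto_eventually, rule eventually_at_top_linorderI[of t0])
        (rule scalar_ode_stays_at_zero[OF lip sol t0])
    then show ?thesis ..
  next
    case False
    have "connected ((\<lambda>t. g (s t)) ` {0..})"
      using halfline_solution_properties(1)[OF sol]
      by (intro connected_continuous_image continuous_on_compose2[OF g]) auto
    then have "(\<forall>t\<ge>0. g (s t) > 0) \<or> (\<forall>t\<ge>0. g (s t) < 0)"
      using False unfolding connected_iff_interval
      by (smt (verit, best) atLeast_iff image_iff)
    then show ?thesis
    proof
      assume "\<forall>t\<ge>0. g (s t) > 0"
      then show ?thesis
        using scalar_ode_converges_if_increasing[of R g s] dissipative(1) sol by auto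
    next
      assume neg: "\<forall>t\<ge>0. g (s t) < 0"
      have "\<exists>l. ((\<lambda>t. - s t) \<longlongrightarrow> l) at_top"
      proof (rule scalar_ode_converges_if_increasing[of R "\<lambda>x. - g (- x)" "\<lambda>t. - s t"])
        show "- g (- x) \<le> 0" if "R < x" for x using dissipative(2)[of "- x"] that by simp
      qed (use neg sol in \<open>auto intro!: derivative_eq_intros\<close>)
      then show ?thesis using tendsto_minus_cancel_left by (metis minus_minus)
    qed
  qed
  then obtain l where l: "(s \<longlongrightarrow> l) at_top" ..
  moreover have "g l = 0"
    using g l sol by (intro scalar_ode_limit_is_zero[where s = s]) (auto simp: continuous_on_eq_continuous_at)
  ultimately show ?thesis using that by blast
qed

section \<open>A bistable reaction that is linear around its middle zero\<close>

text \<open>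
  A function that vanishes to first order at \<open>0\<close> can be cut off to the left of \<open>0\<close> without losing
  differentiability.
\<close>

lemma has_derivative_positive_part_comp:
  assumes d: "\<And>t. 0 \<le> t \<Longrightarrow> (\<phi> has_real_derivative \<phi>' t) (at t)" and "\<phi> 0 = 0" "\<phi>' 0 = 0"
  shows "((\<lambda>t. \<phi> (max 0 t)) has_real_derivative \<phi>' (max 0 t)) (at t)"
proof -
  consider "t < 0" | "t = 0" | "t > 0" by linarith
  then show ?thesis
  proof cases
    case 1
    then have "\<forall>\<^sub>F r in nhds t. \<phi> (max 0 r) = 0"
      using assms(2) by (intro eventually_mono[OF eventually_nhds_in_open[of "{..<0}"]]) auto
    from DERIV_cong_ev[OF refl this refl] show ?thesis
      using 1 assms(3) by simp
  next
    case 3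
    then have "\<forall>\<^sub>F r in nhds t. \<phi> (max 0 r) = \<phi> r"
      by (intro eventually_mono[OF eventually_nhds_in_open[of "{0<..}"]]) auto
    from DERIV_cong_ev[OF refl this refl] show ?thesis
      using 3 d[of t] by simp
  next
    case 2
    have "((\<lambda>h. \<phi> h / h) \<longlongrightarrow> 0) (at 0)"
      using d[of 0] assms(2,3) by (simp add: DERIV_def)
    then have r: "((\<lambda>h. \<phi> h / h) \<longlongrightarrow> 0) (at_right 0)"
      using filterlim_at_split by blast
    have "((\<lambda>h. \<phi> (max 0 h) / h) \<longlongrightarrow> 0) (at 0)"
    proof (rule filterlim_split_at)
      show "((\<lambda>h. \<phi> (max 0 h) / h) \<longlongrightarrow> 0) (at_left 0)"
        using assms(2) by (intro tendsto_eventually) (auto simp: eventually_at_filter max_def)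
      show "((\<lambda>h. \<phi> (max 0 h) / h) \<longlongrightarrow> 0) (at_right 0)"
        by (rule Lim_transform_eventually[OF r]) (auto simp: eventually_at_filter max_def)
    qed
    then show ?thesis using 2 assms(2,3) by (simp add: DERIV_def)
  qed
qed

text \<open>
  A \<open>C\<^sup>2\<close> function that is \<open>0\<close> on the negative half line and of linear growth on the positive one.
  The cube makes the second derivative continuous at \<open>0\<close>; the denominator keeps the first
  derivative bounded.
\<close>

definition excess :: "real \<Rightarrow> real" where
  "excess t = (max 0 t) ^ 3 / (1 + (max 0 t)\<^sup>2)"
definition excess' :: "real \<Rightarrow> real" where
  "excess' t = (3 * (max 0 t)\<^sup>2 + (max 0 t) ^ 4) / (1 + (max 0 t)\<^sup>2)\<^sup>2"
definition excess'' :: "real \<Rightarrow> real" where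
  "excess'' t = (6 * max 0 t - 2 * (max 0 t) ^ 3) / (1 + (max 0 t)\<^sup>2) ^ 3"

lemma one_plus_square_nonzero: "1 + t\<^sup>2 \<noteq> (0::real)"
  using zero_le_power2[of t] by linarith

lemma excess_has_derivative: "(excess has_real_derivative excess' t) (at t)"
proof -
  have "((\<lambda>t. t ^ 3 / (1 + t\<^sup>2)) has_real_derivative (3 * t\<^sup>2 + t ^ 4) / (1 + t\<^sup>2)\<^sup>2) (at t)" for t :: real
    using one_plus_square_nonzero[of t]
    by (auto intro!: derivative_eq_intros simp: field_simps eval_nat_numeral)
  from has_derivative_positive_part_comp[OF this] show ?thesis
    unfolding excess_def[abs_def] excess'_def by simp
qed

lemma excess'_has_derivative: "(excess' has_real_derivative excess'' t) (at t)"
proof -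
  have "((\<lambda>t. (3 * t\<^sup>2 + t ^ 4) / (1 + t\<^sup>2)\<^sup>2) has_real_derivative
      (6 * t - 2 * t ^ 3) / (1 + t\<^sup>2) ^ 3) (at t)" for t :: real
  proof -
    have nz: "1 + t\<^sup>2 \<noteq> 0" by (rule one_plus_square_nonzero)
    have "((\<lambda>t. (3 * t\<^sup>2 + t ^ 4) / (1 + t\<^sup>2)\<^sup>2) has_real_derivative
      ((6 * t + 4 * t ^ 3) * (1 + t\<^sup>2)\<^sup>2 - (3 * t\<^sup>2 + t ^ 4) * (2 * (1 + t\<^sup>2) * (2 * t)))
        / ((1 + t\<^sup>2)\<^sup>2 * (1 + t\<^sup>2)\<^sup>2)) (at t)"
      using nz by (auto intro!: derivative_eq_intros)
    also have "((6 * t + 4 * t ^ 3) * (1 + t\<^sup>2)\<^sup>2 - (3 * t\<^sup>2 + t ^ 4) * (2 * (1 + t\<^sup>2) * (2 * t)))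
        = (6 * t - 2 * t ^ 3) * (1 + t\<^sup>2)"
      by algebra
    also have "(6 * t - 2 * t ^ 3) * (1 + t\<^sup>2) / ((1 + t\<^sup>2)\<^sup>2 * (1 + t\<^sup>2)\<^sup>2)
        = (6 * t - 2 * t ^ 3) / (1 + t\<^sup>2) ^ 3"
      using nz by (simp add: divide_simps) algebra
    finally show ?thesis .
  qed
  from has_derivative_positive_part_comp[OF this] show ?thesis
    unfolding excess'_def[abs_def] excess''_def by simp
qed

lemma continuous_excess'': "continuous_on UNIV excess''"
  unfolding excess''_def[abs_def] 
  by (intro continuous_intros) (use one_plus_square_nonzero in auto)

lemma excess_nonpos [simp]: "t \<le> 0 \<Longrightarrow> excess t = 0"
  by (simp add: excess_def)

lemma excess'_bounds: "0 \<le> excess' t" "excess' t \<le> 2"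
proof -
  show "0 \<le> excess' t"
    unfolding excess'_def by (intro divide_nonneg_nonneg add_nonneg_nonneg) auto
  define p where "p = max 0 t"
  have "3 * p\<^sup>2 + p ^ 4 \<le> 2 * (1 + p\<^sup>2)\<^sup>2"
  proof -
    have "2 * (1 + p\<^sup>2)\<^sup>2 - (3 * p\<^sup>2 + p ^ 4) = 2 + p\<^sup>2 + p ^ 4" by algebra
    then show ?thesis using zero_le_power2[of p] zero_le_even_power[of 4 p] by simp
  qed
  moreover have "0 < (1 + p\<^sup>2)\<^sup>2"
    using one_plus_square_nonzero[of p] by simp
  ultimately show "excess' t \<le> 2"
    unfolding excess'_def p_def[symmetric] by (simp add: pos_divide_le_eq)
qed

text \<open>
  The factor \<open>4\<close> puts the outer zeros at \<open>2\<close> and \<open>-2\<close>: with \<open>p = s - 1 \<ge> 0\<close> the numerator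
  of \<open>bistable s\<close> is \<open>(1 + p) (1 + p\<^sup>2) - 4 p\<^sup>3\<close>, which has the root \<open>p = 1\<close>.
\<close>

definition bistable :: "real \<Rightarrow> real" where
  "bistable s = s - 4 * excess (s - 1) + 4 * excess (- s - 1)"
definition bistable' :: "real \<Rightarrow> real" where
  "bistable' s = 1 - 4 * excess' (s - 1) - 4 * excess' (- s - 1)"
definition bistable'' :: "real \<Rightarrow> real" where
  "bistable'' s = - 4 * excess'' (s - 1) + 4 * excess'' (- s - 1)"

lemma bistable_has_derivative: "(bistable has_real_derivative bistable' s) (at s)"
  unfolding bistable_def[abs_def] bistable'_def
  by (auto intro!: derivative_eq_intros DERIV_chain2[OF excess_has_derivative])

lemma bistable'_has_derivative: "(bistable' has_real_derivative bistable'' s) (at s)"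
  unfolding bistable'_def[abs_def] bistable''_def
  by (auto intro!: derivative_eq_intros DERIV_chain2[OF excess'_has_derivative])

lemma continuous_bistable'': "continuous_on UNIV bistable''"
  unfolding bistable''_def[abs_def]
  by (intro continuous_intros continuous_on_compose2[OF continuous_excess'']) auto

text \<open>
  The lower bound is what makes the system cooperative, since the relaxation towards the mean has
  rate \<open>16 > 15\<close>; both bounds together give the Lipschitz constant.
\<close>

lemma bistable'_bounds: "- 15 \<le> bistable' s" "bistable' s \<le> 1"
  using excess'_bounds[of "s - 1"] excess'_bounds[of "- s - 1"] by (simp_all add: bistable'_def)

lemma bistable_lipschitz: "\<bar>bistable x - bistable y\<bar> \<le> 15 * \<bar>x - y\<bar>"
  using field_differentiable_bound[of UNIV bistable bistable' 15 y x]
    bistable_has_derivative bistable'_bounds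
  by (smt (verit) UNIV_I convex_UNIV real_norm_def)

lemma bistable_minus: "bistable (- s) = - bistable s"
  by (simp add: bistable_def)

lemma bistable_linear: "\<bar>s\<bar> \<le> 1 \<Longrightarrow> bistable s = s"
  by (simp add: bistable_def)

text \<open>
  The quadratic cofactor \<open>3 p\<^sup>2 + 2 p + 1\<close> of the root \<open>p = 1\<close> is positive, so beyond \<open>1\<close> the
  reaction has the sign of \<open>2 - s\<close>. This yields both the zeros and the dissipativity.
\<close>

lemma bistable_beyond_1:
  assumes "1 \<le> s"
  obtains q where "q > 0" "bistable s = (2 - s) * q"
proof
  define p where "p = s - 1"
  have p: "0 \<le> p" "s = 1 + p" using assms by (auto simp: p_def)
  have pos: "0 < 1 + p\<^sup>2" by (simp add: add_pos_nonneg)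
  have "bistable s = 1 + p - 4 * (p ^ 3 / (1 + p\<^sup>2))"
    using p by (simp add: bistable_def excess_def)
  also have "\<dots> = ((1 + p) * (1 + p\<^sup>2) - 4 * p ^ 3) / (1 + p\<^sup>2)"
    using pos by (simp add: diff_divide_distrib)
  also have "(1 + p) * (1 + p\<^sup>2) - 4 * p ^ 3 = (1 - p) * (3 * p\<^sup>2 + 2 * p + 1)" by algebra
  finally show "bistable s = (2 - s) * ((3 * p\<^sup>2 + 2 * p + 1) / (1 + p\<^sup>2))"
    using p by simp
  show "(3 * p\<^sup>2 + 2 * p + 1) / (1 + p\<^sup>2) > 0"
    using p pos by (intro divide_pos_pos) (auto intro!: add_nonneg_pos)
qed

lemma bistable_dissipative: "s > 2 \<Longrightarrow> bistable s \<le> 0" "s < - 2 \<Longrightarrow> bistable s \<ge> 0"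
proof -
  have *: "bistable s \<le> 0" if s: "s > 2" for s
  proof -
    obtain q where "q > 0" "bistable s = (2 - s) * q"
      using bistable_beyond_1[of s] s by auto
    then show ?thesis using s by (simp add: mult_le_0_iff)
  qed
  then show "s > 2 \<Longrightarrow> bistable s \<le> 0" .
  show "s < - 2 \<Longrightarrow> bistable s \<ge> 0"
    using *[of "- s"] by (simp add: bistable_minus)
qed

lemma bistable_zero_iff: "bistable s = 0 \<longleftrightarrow> s \<in> {- 2, 0, 2}"
proof -
  have beyond: "bistable r = 0 \<longleftrightarrow> r = 2" if r: "1 \<le> r" for r
  proof -
    obtain q where "q > 0" "bistable r = (2 - r) * q"
      using bistable_beyond_1[OF r] .
    then show ?thesis by auto
  qed
  consider "1 \<le> s" | "\<bar>s\<bar> \<le> 1" | "1 \<le> - s" by linarith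
  then show ?thesis
  proof cases
    case 1 then show ?thesis using beyond by auto
  next
    case 2 then show ?thesis using bistable_linear by auto
  next
    case 3 then show ?thesis using beyond[OF 3] by (auto simp: bistable_minus)
  qed
qed

section \<open>A cooperative system driven by its mean\<close>

definition mean :: "nat \<Rightarrow> (nat \<Rightarrow> real) \<Rightarrow> real" where
  "mean n u = (\<Sum>j<n. u j) / real n"

text \<open>
  The relaxation to the mean couples the components strongly enough to make the system cooperative,
  and it adds up to \<open>0\<close>, so that it leaves the dynamics of the mean itself unchanged.
\<close>

definition reaction :: "nat \<Rightarrow> nat \<Rightarrow> (nat \<Rightarrow> real) \<Rightarrow> real" where
  "reaction n i u = bistable (mean n u) + 16 * (mean n u - u i)"

lemma mean_const: "0 < n \<Longrightarrow> (\<And>i. i < n \<Longrightarrow> u i = z) \<Longrightarrow> mean n u = z"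
  by (simp add: mean_def)

lemma sum_deviations_from_mean: "0 < n \<Longrightarrow> (\<Sum>i<n. mean n u - u i) = 0"
  by (simp add: mean_def sum_subtractf)

text \<open>
  Summing over the components cancels the relaxation terms, so the mean of any solution obeys the
  scalar equation with right-hand side \<open>bistable\<close>.
\<close>

lemma mean_reaction:
  assumes "0 < n"
  shows "mean n (\<lambda>i. reaction n i u) = bistable (mean n u)"
proof -
  have "(\<Sum>i<n. reaction n i u) = real n * bistable (mean n u)"
    unfolding reaction_def sum.distrib sum_distrib_left[symmetric] sum_deviations_from_mean[OF assms]
    by simp
  then show ?thesis
    using assms by (simp add: mean_def[of n "\<lambda>i. reaction n i u"])
qed

lemma reaction_as_ridges:
  assumes "i < n"
  shows "reaction n i u = bistable (\<Sum>l<n. 1 / real n * u l)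
      + (\<Sum>l<n. (16 / real n - (if l = i then 16 else 0)) * u l)"
proof -
  have "(\<Sum>l<n. (if l = i then 16 else 0) * u l) = (\<Sum>l<n. if l = i then 16 * u i else 0)"
    by (intro sum.cong) auto
  also have "\<dots> = 16 * u i" using assms by simp
  finally have d: "(\<Sum>l<n. (if l = i then 16 else 0) * u l) = 16 * u i" .
  have "(\<Sum>l<n. (16 / real n - (if l = i then 16 else 0)) * u l)
      = 16 * mean n u - (\<Sum>l<n. (if l = i then 16 else 0) * u l)"
    by (simp only: left_diff_distrib sum_subtractf)
      (simp add: mean_def sum_divide_distrib sum_distrib_left)
  then show ?thesis
    unfolding d reaction_def by (simp add: mean_def sum_divide_distrib)
qed

lemma reaction_C2:
  assumes "i < n"
  shows "C_k n 2 (Rn n) (reaction n i)"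
proof -
  let ?\<phi> = "\<lambda>k. [bistable, bistable', bistable''] ! k"
  let ?\<psi> = "\<lambda>k. [\<lambda>t. t, \<lambda>t. 1, \<lambda>t. 0 :: real] ! k"
  have "C_k n 2 (Rn n) (\<lambda>u. 1 * ?\<phi> 0 (\<Sum>l<n. 1 / real n * u l))"
    by (rule C_k_ridge)
      (auto simp: less_2_cases_iff bistable_has_derivative bistable'_has_derivative
        continuous_bistable'')
  moreover have "C_k n 2 (Rn n) (\<lambda>u. 1 * ?\<psi> 0 (\<Sum>l<n. (16 / real n - (if l = i then 16 else 0)) * u l))"
    by (rule C_k_ridge) (auto simp: less_2_cases_iff)
  ultimately have "C_k n 2 (Rn n) (\<lambda>u. 1 * ?\<phi> 0 (\<Sum>l<n. 1 / real n * u l)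
      + 1 * ?\<psi> 0 (\<Sum>l<n. (16 / real n - (if l = i then 16 else 0)) * u l))"
    by (rule C_k_add[OF openin_topspace])
  then show ?thesis
    by (simp add: reaction_as_ridges[OF assms, abs_def])
qed

text \<open>
  A change of \<open>u j\<close> acts on component \<open>i\<close> only through the mean, which gives the derivative
  \<open>(bistable' + 16) / n\<close>.
\<close>

lemma reaction_partial_deriv_pos:
  assumes "i < n" "j < n" "i \<noteq> j"
  shows "partial_deriv j (reaction n i) u > 0"
proof -
  have "((\<lambda>t. reaction n i (u(j := t))) has_real_derivative
      bistable' (\<Sum>l<n. 1 / real n * u l) * (1 / real n) + 1 * (16 / real n - (if j = i then 16 else 0)))
      (at (u j))"
    unfolding reaction_as_ridges[OF assms(1)]
    by (intro DERIV_add has_partial_deriv_ridge assms bistable_has_derivative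
        has_partial_deriv_ridge[where \<phi> = "\<lambda>t. t"] DERIV_ident)
  then have "partial_deriv j (reaction n i) u = (bistable' (\<Sum>l<n. 1 / real n * u l) + 16) / real n"
    using assms(3) by (simp add: partial_deriv_def DERIV_imp_deriv add_divide_distrib)
  also have "\<dots> > 0"
    using bistable'_bounds(1)[of "\<Sum>l<n. 1 / real n * u l"] assms(1) by simp
  finally show ?thesis .
qed

lemma reaction_zero_iff:
  assumes "0 < n"
  shows "(\<forall>i<n. reaction n i e = 0) \<longleftrightarrow> (\<exists>z\<in>{- 2, 0, 2}. \<forall>i<n. e i = z)"
proof
  assume *: "\<forall>i<n. reaction n i e = 0"
  then have "bistable (mean n e) = 0"
    using mean_reaction[OF assms, of e] by (simp add: mean_def)
  then show "\<exists>z\<in>{- 2, 0, 2}. \<forall>i<n. e i = z"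
    using * bistable_zero_iff[of "mean n e"]
    by (intro bexI[of _ "mean n e"]) (simp_all add: reaction_def)
next
  assume "\<exists>z\<in>{- 2, 0, 2}. \<forall>i<n. e i = z"
  then obtain z where z: "z \<in> {- 2, 0, 2}" "\<forall>i<n. e i = z" by blast
  have "mean n e = z" by (rule mean_const[OF assms]) (use z(2) in blast)
  moreover have "bistable z = 0" using z(1) by (simp only: bistable_zero_iff)
  ultimately show "\<forall>i<n. reaction n i e = 0"
    using z(2) by (simp add: reaction_def)
qed

lemma ode_equilibria_reaction:
  assumes "0 < n"
  shows "ode_equilibria n (reaction n) = (\<lambda>z i. if i < n then z else 0) ` {- 2, 0, 2}"
proof
  show "ode_equilibria n (reaction n) \<subseteq> (\<lambda>z i. if i < n then z else 0) ` {- 2, 0, 2}"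
  proof
    fix e assume "e \<in> ode_equilibria n (reaction n)"
    then have e: "e \<in> Rn n" "\<forall>i<n. reaction n i e = 0"
      by (auto simp: ode_equilibria_def)
    then obtain z where z: "z \<in> {- 2, 0, 2}" "\<forall>i<n. e i = z"
      using reaction_zero_iff[OF assms] by blast
    have "e = (\<lambda>i. if i < n then z else 0)"
      using e(1) z(2) by (intro ext) (simp add: topspace_Euclidean_space)
    with z(1) show "e \<in> (\<lambda>z i. if i < n then z else 0) ` {- 2, 0, 2}" by blast
  qed
  show "(\<lambda>z i. if i < n then z else 0) ` {- 2, 0, 2} \<subseteq> ode_equilibria n (reaction n)"
  proof (rule image_subsetI)
    fix z :: real assume "z \<in> {- 2, 0, 2}"
    then have "\<forall>i<n. reaction n i (\<lambda>i. if i < n then z else 0) = 0"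
      unfolding reaction_zero_iff[OF assms] by (intro bexI[of _ z]) auto
    then show "(\<lambda>i. if i < n then z else 0) \<in> ode_equilibria n (reaction n)"
      by (auto simp: ode_equilibria_def topspace_Euclidean_space)
  qed
qed

lemma card_ode_equilibria_reaction:
  assumes "0 < n"
  shows "card (ode_equilibria n (reaction n)) = 3"
proof -
  have "inj_on (\<lambda>z i. if i < n then z else 0 :: real) {- 2, 0, 2}"
    using assms by (intro inj_onI) (metis (full_types))
  then show ?thesis
    unfolding ode_equilibria_reaction[OF assms] by (subst card_image) simp_all
qed

text \<open>
  In the coordinates consisting of the mean and the deviations from it the system decouples into the
  scalar bistable equation and linear decay, so a solution can be written down from a scalar one.
\<close>

lemma reaction_solution_exists:
  assumes n: "0 < n" and a: "a \<in> Rn n"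
  shows "\<exists>u. ode_solution n (reaction n) u \<and> u 0 = a"
proof -
  obtain s where s0: "s 0 = mean n a"
    and s: "\<And>t. 0 \<le> t \<Longrightarrow> (s has_real_derivative bistable (s t)) (at t within {0..})"
    using lipschitz_scalar_ode_solvable[of 15 bistable "mean n a"] bistable_lipschitz by auto
  define u where "u t i = (if i < n then s t + (a i - mean n a) * exp (- 16 * t) else 0)" for t i
  have mean_u: "mean n (u t) = s t" for t
  proof -
    have "(\<Sum>i<n. u t i) = (\<Sum>i<n. s t - (mean n a - a i) * exp (- 16 * t))"
      by (intro sum.cong) (auto simp: u_def algebra_simps)
    also have "\<dots> = real n * s t"
      using sum_deviations_from_mean[OF n, of a] by (simp add: sum_subtractf flip: sum_distrib_right)
    finally show ?thesis using n by (simp add: mean_def)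
  qed
  have "ode_solution n (reaction n) u"
    unfolding ode_solution_def
  proof (intro allI impI conjI)
    fix t :: real and i assume t: "0 \<le> t"
    show "u t \<in> Rn n" by (auto simp: topspace_Euclidean_space u_def)
    assume i: "i < n"
    have "((\<lambda>t. s t + (a i - mean n a) * exp (- 16 * t)) has_real_derivative
        bistable (s t) + (a i - mean n a) * (exp (- 16 * t) * (- 16))) (at t within {0..})"
      by (auto intro!: derivative_eq_intros s[OF t])
    also have "bistable (s t) + (a i - mean n a) * (exp (- 16 * t) * (- 16)) = reaction n i (u t)"
      using i by (simp add: reaction_def mean_u) (simp add: u_def)
    finally show "((\<lambda>t. u t i) has_real_derivative reaction n i (u t)) (at t within {0..})"
      using i by (simp add: u_def)
  qed
  moreover have "u 0 = a"
    using a by (auto simp: u_def s0 topspace_Euclidean_space)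
  ultimately show ?thesis by blast
qed

text \<open>
  The product \<open>w t * exp (c t)\<close> is constant.
\<close>

lemma linear_decay_ode_tendsto_zero:
  fixes w :: "real \<Rightarrow> real"
  assumes c: "c > 0" and w: "\<And>t. 0 \<le> t \<Longrightarrow> (w has_real_derivative - c * w t) (at t within {0..})"
  shows "(w \<longlongrightarrow> 0) at_top"
proof -
  have "((\<lambda>t. w t * exp (c * t)) has_real_derivative 0) (at t within {0..})" if "0 \<le> t" for t
    by (auto intro!: derivative_eq_intros w[OF that])
  then obtain k where k: "\<And>t. 0 \<le> t \<Longrightarrow> w t * exp (c * t) = k"
    using has_field_derivative_zero_constant[of "{0..}" "\<lambda>t. w t * exp (c * t)"] by auto
  then have const: "w t * exp (c * t) = w 0" if "0 \<le> t" for t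
    using k[OF that] k[of 0] by simp
  have "w 0 * exp (- (c * t)) = w t" if "0 \<le> t" for t
    using const[OF that] by (simp add: exp_minus field_simps)
  then have ev: "\<forall>\<^sub>F t in at_top. w 0 * exp (- (c * t)) = w t"
    by (rule eventually_at_top_linorderI)
  have "filterlim (\<lambda>t. c * t) at_top at_top"
    by (rule filterlim_tendsto_pos_mult_at_top[OF tendsto_const c filterlim_ident])
  then have "filterlim (\<lambda>t. - (c * t)) at_bot at_top"
    by (rule filterlim_compose[OF filterlim_uminus_at_bot_at_top])
  then have "((\<lambda>t. w 0 * exp (- (c * t))) \<longlongrightarrow> w 0 * 0) at_top"
    by (intro tendsto_mult tendsto_const filterlim_compose[OF exp_at_bot])
  then show ?thesis
    using Lim_transform_eventually[OF _ ev] by simp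
qed

lemma limitin_Euclidean_spaceI:
  assumes "e \<in> Rn n" "\<forall>\<^sub>F t in F. u t \<in> Rn n" "\<And>i. i < n \<Longrightarrow> ((\<lambda>t. u t i) \<longlongrightarrow> e i) F"
  shows "limitin (Euclidean_space n) u e F"
proof -
  have "((\<lambda>t. u t i) \<longlongrightarrow> e i) F" for i
  proof (cases "i < n")
    case False
    then have "\<forall>\<^sub>F t in F. u t i = e i"
      using assms(1) by (intro eventually_mono[OF assms(2)]) (auto simp: topspace_Euclidean_space)
    then show ?thesis by (rule tendsto_eventually)
  qed (rule assms(3))
  then show ?thesis
    using assms(1,2)
    by (simp add: Euclidean_space_def limitin_subtopology limitin_componentwise)
qed

text \<open>
  The mean converges to a zero \<open>z\<close> of \<open>bistable\<close>, and the deviations from the mean decay, so every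
  component converges to \<open>z\<close>.
\<close>

lemma reaction_solution_converges:
  assumes n: "0 < n" and sol: "ode_solution n (reaction n) u"
  shows "\<exists>e\<in>ode_equilibria n (reaction n). limitin (Euclidean_space n) u e at_top"
proof -
  have uR: "u t \<in> Rn n" if "0 \<le> t" for t
    using sol that by (auto simp: ode_solution_def)
  have du: "((\<lambda>t. u t i) has_real_derivative reaction n i (u t)) (at t within {0..})"
    if "0 \<le> t" "i < n" for t i
    using sol that by (auto simp: ode_solution_def)
  define s where "s t = mean n (u t)" for t
  have s: "(s has_real_derivative bistable (s t)) (at t within {0..})" if "0 \<le> t" for t
  proof -
    have "((\<lambda>t. (\<Sum>i<n. u t i) / real n) has_real_derivative (\<Sum>i<n. reaction n i (u t)) / real n)
        (at t within {0..})"
      using du[OF that] by (intro DERIV_cdivide DERIV_sum) auto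
    then show ?thesis
      using mean_reaction[OF n, of "u t"] by (simp add: s_def[abs_def] mean_def)
  qed
  then obtain z where z: "bistable z = 0" "(s \<longlongrightarrow> z) at_top"
    using dissipative_scalar_ode_converges[of bistable 15 2 s] bistable_lipschitz bistable_dissipative
    by auto
  let ?e = "\<lambda>i. if i < n then z else 0"
  have "((\<lambda>t. u t i) \<longlongrightarrow> z) at_top" if i: "i < n" for i
  proof -
    have "((\<lambda>t. u t i - s t) has_real_derivative - 16 * (u t i - s t)) (at t within {0..})"
      if t: "0 \<le> t" for t
      using DERIV_diff[OF du[OF t i] s[OF t]] by (simp add: reaction_def s_def algebra_simps)
    then have "((\<lambda>t. u t i - s t) \<longlongrightarrow> 0) at_top"
      by (intro linear_decay_ode_tendsto_zero[of 16]) auto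
    from tendsto_add[OF this z(2)] show ?thesis by simp
  qed
  then have "limitin (Euclidean_space n) u ?e at_top"
    using uR by (intro limitin_Euclidean_spaceI)
      (auto simp: topspace_Euclidean_space intro!: eventually_at_top_linorderI[of 0])
  moreover have "?e \<in> ode_equilibria n (reaction n)"
    using z(1) bistable_zero_iff by (auto simp: ode_equilibria_reaction[OF n])
  ultimately show ?thesis by blast
qed

section \<open>There are at most continuum many equilibria\<close>

text \<open>
  Equilibria are continuous on the closure of the domain, hence determined by their values on a
  countable dense subset \<open>T\<close>, and a real number is determined by the rationals below it. So an
  equilibrium is encoded by a subset of the countable set \<open>T \<times> \<rat> \<times> {..<n}\<close>.
\<close>

lemma rd_equilibria_lepoll_reals:
  "rd_equilibria n m d f \<Omega> \<lesssim> (UNIV :: real set)"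
proof -
  let ?K = "Euclidean_space m closure_of \<Omega>"
  have K: "?K \<subseteq> Rn m" by (rule closure_of_subset_topspace)
  obtain T where T: "countable T" "T \<subseteq> ?K" "?K \<subseteq> closure T"
    using separable by blast
  define C where "C = T \<times> (\<rat> :: real set) \<times> {..<n}"
  have "countable C"
    unfolding C_def using T(1) by (intro countable_SIGMA countable_rat) auto
  define code where "code u = {(q, r, i) \<in> C. r < u q i}" for u :: "(nat \<Rightarrow> real) \<Rightarrow> nat \<Rightarrow> real"
  have "inj_on code (rd_equilibria n m d f \<Omega>)"
  proof (rule inj_onI)
    fix u v assume u: "u \<in> rd_equilibria n m d f \<Omega>" and v: "v \<in> rd_equilibria n m d f \<Omega>"
      and eq: "code u = code v"
    have cont: "continuous_on ?K (\<lambda>x. w x i)" if "w \<in> rd_equilibria n m d f \<Omega>" "i < n" for w i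
      using that continuous_in_iff_continuous_on[OF K] by (auto simp: rd_equilibria_def C1_closure_def)
    have range: "w x i = 0" if "w \<in> rd_equilibria n m d f \<Omega>" "x \<in> ?K" "n \<le> i" for w x i
      using that by (auto simp: rd_equilibria_def PiE_iff topspace_Euclidean_space)
    have on_T: "u q i = v q i" if "q \<in> T" "i < n" for q i
    proof -
      have "r < u q i \<longleftrightarrow> r < v q i" if "r \<in> \<rat>" for r
        using eq that \<open>q \<in> T\<close> \<open>i < n\<close> by (auto simp: code_def C_def set_eq_iff)
      then show ?thesis
        by (metis Rats_dense_in_real less_asym linorder_less_linear)
    qed
    have "u x i = v x i" if x: "x \<in> ?K" for x i
    proof (cases "i < n")
      case True
      have "x \<in> top_of_set ?K closure_of T"
        using x T by (auto simp: closure_of_subtopology Int_absorb1)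
      then show ?thesis
        using cont[OF u True] cont[OF v True] on_T[OF _ True]
        by (intro forall_in_closure_of_eq[of x "top_of_set ?K" T euclideanreal "\<lambda>x. u x i" "\<lambda>x. v x i"])
          auto
    next
      case False
      then show ?thesis using range[OF u x] range[OF v x] by simp
    qed
    then show "u = v"
      using u v by (intro PiE_ext[of u ?K "\<lambda>_. Rn n" v]) (auto simp: rd_equilibria_def)
  qed
  moreover have "code ` rd_equilibria n m d f \<Omega> \<subseteq> Pow C"
    by (auto simp: code_def)
  ultimately have "rd_equilibria n m d f \<Omega> \<lesssim> Pow C"
    unfolding lepoll_def by blast
  also have "Pow C \<lesssim> (UNIV :: nat set set)"
    using \<open>countable C\<close> unfolding lepoll_def by (meson countableE inj_on_image_Pow subset_UNIV)
  also have "(UNIV :: nat set set) \<approx> (UNIV :: real set)"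
    by (rule nat_sets_eqpoll_reals)
  finally show ?thesis .
qed


section \<open>The interval as a smooth domain\<close>

definition line_point :: "real \<Rightarrow> nat \<Rightarrow> real" where
  "line_point t = (\<lambda>i. if i = 0 then t else 0)"

definition segment :: "(nat \<Rightarrow> real) set" where
  "segment = {x \<in> Rn 1. 0 < x 0 \<and> x 0 < pi}"

lemma line_point_0 [simp]: "line_point t 0 = t"
  by (simp add: line_point_def)

lemma line_point_in_Rn_1 [simp]: "line_point t \<in> Rn 1"
  by (simp add: line_point_def topspace_Euclidean_space)

lemma Rn_1_eq_line_point: "x \<in> Rn 1 \<Longrightarrow> x = line_point (x 0)"
  by (auto simp: line_point_def topspace_Euclidean_space)

lemma update_Rn_1: "x \<in> Rn 1 \<Longrightarrow> x(0 := t) = line_point t"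
  by (auto simp: line_point_def topspace_Euclidean_space)

lemma continuous_on_coordinate: "continuous_on S (\<lambda>x :: nat \<Rightarrow> real. x i)"
  by (rule continuous_on_subset[OF continuous_on_product_coordinates]) auto

lemma continuous_on_line_point: "continuous_on S line_point"
proof (rule continuous_on_coordinatewise_then_product)
  fix i show "continuous_on S (\<lambda>t. line_point t i)"
    by (cases "i = 0") (auto simp: line_point_def)
qed

lemma openin_Rn_1_coordinate:
  assumes "open A"
  shows "openin (Euclidean_space 1) {x \<in> Rn 1. x 0 \<in> A}"
proof -
  have "open ((\<lambda>x :: nat \<Rightarrow> real. x 0) -` A)"
    using assms continuous_on_coordinate by (rule open_vimage)
  moreover have "{x \<in> Rn 1. x 0 \<in> A} = {x. \<forall>i\<ge>1. x i = 0} \<inter> (\<lambda>x. x 0) -` A"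
    by (auto simp: topspace_Euclidean_space)
  ultimately show ?thesis
    unfolding Euclidean_space_eq_top_of_set openin_open by blast
qed

lemma openin_segment: "openin (Euclidean_space 1) segment"
  using openin_Rn_1_coordinate[of "{0<..<pi}"] by (simp add: segment_def)

lemma line_point_in_segment_iff [simp]: "line_point t \<in> segment \<longleftrightarrow> 0 < t \<and> t < pi"
  unfolding segment_def using line_point_in_Rn_1 by simp

lemma segment_subset_closure: "segment \<subseteq> Euclidean_space 1 closure_of segment"
  using openin_subset[OF openin_segment] by (rule closure_of_subset)

lemma closure_segment_subset:
  "Euclidean_space 1 closure_of segment \<subseteq> {x \<in> Rn 1. 0 \<le> x 0 \<and> x 0 \<le> pi}"
proof (rule closure_of_minimal)
  have "closed {x :: nat \<Rightarrow> real. 0 \<le> x 0 \<and> x 0 \<le> pi}"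
    by (intro closed_Collect_conj closed_Collect_le continuous_on_const continuous_on_coordinate)
  moreover have "closed (Rn 1)"
    using closedin_Euclidean_imp_closed closedin_topspace by blast
  ultimately have "closed (Rn 1 \<inter> {x. 0 \<le> x 0 \<and> x 0 \<le> pi})" by blast
  then show "closedin (Euclidean_space 1) {x \<in> Rn 1. 0 \<le> x 0 \<and> x 0 \<le> pi}"
    unfolding closedin_Euclidean_space_iff by (simp add: Collect_conj_eq)
qed (auto simp: segment_def)

lemma frontier_segment:
  assumes "x \<in> Euclidean_space 1 frontier_of segment"
  shows "x \<in> Euclidean_space 1 closure_of segment" "x \<in> Rn 1" "x \<notin> segment" "x 0 = 0 \<or> x 0 = pi"
proof -
  show x: "x \<in> Euclidean_space 1 closure_of segment" and nx: "x \<notin> segment"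
    using assms unfolding frontier_of_def interior_of_openin[OF openin_segment] by blast+
  show "x \<in> Rn 1" "x 0 = 0 \<or> x 0 = pi"
    using x nx closure_segment_subset by (auto simp: segment_def)
qed

lemma connected_segment: "connectedin (Euclidean_space 1) segment"
proof -
  have "continuous_map euclideanreal (Euclidean_space 1) line_point"
    unfolding Euclidean_space_eq_top_of_set
    by (intro continuous_map_into_subtopology)
      (simp add: continuous_on_line_point, auto simp: line_point_def)
  moreover have "connectedin euclideanreal {0<..<pi}" by simp
  ultimately have "connectedin (Euclidean_space 1) (line_point ` {0<..<pi})"
    by (rule connectedin_continuous_map_image)
  moreover have "line_point ` {0<..<pi} = segment"
  proof
    show "line_point ` {0<..<pi} \<subseteq> segment" by auto
    show "segment \<subseteq> line_point ` {0<..<pi}"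
    proof
      fix x assume "x \<in> segment"
      then have "x = line_point (x 0)" "x 0 \<in> {0<..<pi}"
        using Rn_1_eq_line_point by (auto simp: segment_def)
      then show "x \<in> line_point ` {0<..<pi}" by blast
    qed
  qed
  ultimately show ?thesis by simp
qed

text \<open>
  Near an endpoint the segment is a half line, so an affine function defines it there.
\<close>

lemma local_defining_affine:
  assumes A: "open A" "x \<in> Rn 1" "x 0 \<in> A" and "c \<noteq> 0"
    and iff: "\<And>t. t \<in> A \<Longrightarrow> 0 < t \<and> t < pi \<longleftrightarrow> c * (t - p) < 0"
  shows "local_defining 1 segment x {y \<in> Rn 1. y 0 \<in> A} (\<lambda>y. c * (y 0 - p))"
  unfolding local_defining_def
proof (intro conjI allI ballI)
  show "openin (Euclidean_space 1) {y \<in> Rn 1. y 0 \<in> A}"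
    using A(1) by (rule openin_Rn_1_coordinate)
  show "x \<in> {y \<in> Rn 1. y 0 \<in> A}" using A by simp
  show "segment \<inter> {y \<in> Rn 1. y 0 \<in> A} = {y \<in> {y \<in> Rn 1. y 0 \<in> A}. c * (y 0 - p) < 0}"
    using iff by (auto simp: segment_def)
  show "C_k 1 k {y \<in> Rn 1. y 0 \<in> A} (\<lambda>y. c * (y 0 - p))" for k
  proof -
    let ?\<phi> = "\<lambda>(i :: nat) (t :: real). if i = 0 then t - p else if i = 1 then 1 else 0 :: real"
    have "C_k 1 k {y \<in> Rn 1. y 0 \<in> A} (\<lambda>y. c * ?\<phi> 0 (\<Sum>l<1. 1 * y l))"
    proof (rule C_k_ridge[where \<phi> = ?\<phi>])
      fix i :: nat and t :: real
      show "(?\<phi> i has_real_derivative ?\<phi> (Suc i) t) (at t)"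
        by (cases "i = 0") (auto intro!: derivative_eq_intros)
      show "continuous_on UNIV (?\<phi> k)"
        by (cases "k = 0"; cases "k = 1") (simp_all add: continuous_intros)
    qed auto
    then show ?thesis by simp
  qed
  show "\<exists>j<1. partial_deriv j (\<lambda>y. c * (y 0 - p)) y \<noteq> 0" for y
  proof -
    have "((\<lambda>t. c * (t - p)) has_real_derivative c) (at (y 0))"
      by (auto intro!: derivative_eq_intros)
    then show ?thesis
      using \<open>c \<noteq> 0\<close> by (simp add: partial_deriv_def DERIV_imp_deriv)
  qed
qed

lemma smooth_bounded_segment: "smooth_bounded_domain 1 segment"
  unfolding smooth_bounded_domain_def
proof (intro conjI ballI)
  show "segment \<noteq> {}" using line_point_in_segment_iff[of "pi / 2"] by force
  have "sqrt (\<Sum>j<1. (x j)\<^sup>2) \<le> pi" if "x \<in> segment" for x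
    using that by (simp add: segment_def)
  then show "bounded_in 1 segment"
    unfolding bounded_in_def using openin_subset[OF openin_segment] by blast
  fix x assume x: "x \<in> Euclidean_space 1 frontier_of segment"
  from frontier_segment(4)[OF x] show "\<exists>U \<rho>. local_defining 1 segment x U \<rho>"
  proof
    assume "x 0 = 0"
    then have "local_defining 1 segment x {y \<in> Rn 1. y 0 \<in> {..<pi}} (\<lambda>y. - 1 * (y 0 - 0))"
      by (intro local_defining_affine frontier_segment(2)[OF x]) auto
    then show ?thesis by blast
  next
    assume "x 0 = pi"
    then have "local_defining 1 segment x {y \<in> Rn 1. y 0 \<in> {0<..}} (\<lambda>y. 1 * (y 0 - pi))"
      by (intro local_defining_affine frontier_segment(2)[OF x]) auto
    then show ?thesis by blast
  qed
qed (rule openin_segment connected_segment)+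

text \<open>
  The normal is given by an arbitrary defining function \<open>\<rho>\<close>, whose only usable properties are its
  signs: \<open>\<rho> \<ge> 0\<close> at the endpoint and \<open>\<rho> < 0\<close> at nearby points of the segment. If \<open>\<rho>\<close> had a
  positive derivative in the inward direction, it would be positive at such points.
\<close>

lemma outward_normal_segment:
  assumes x: "x \<in> Euclidean_space 1 frontier_of segment" and \<nu>: "outward_normal 1 segment x \<nu>"
  shows "\<nu> = line_point (if x 0 = 0 then - 1 else 1)"
proof -
  define \<sigma> :: real where "\<sigma> = (if x 0 = 0 then 1 else - 1)"
  note fr = frontier_segment[OF x]
  (* \<sigma> is the direction pointing from the endpoint into the segment *)
  have inward: "0 < x 0 + \<sigma> * h \<and> x 0 + \<sigma> * h < pi" if "0 < h" "h < pi" for h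
    using fr(4) that by (auto simp: \<sigma>_def)
  obtain U \<rho> where ld: "local_defining 1 segment x U \<rho>"
    and \<nu>0: "\<nu> 0 = partial_deriv 0 \<rho> x / sqrt ((partial_deriv 0 \<rho> x)\<^sup>2)"
    using \<nu> by (auto simp: outward_normal_def)
  define D where "D = partial_deriv 0 \<rho> x"
  have U: "openin (Euclidean_space 1) U" "x \<in> U" and neg: "\<And>y. y \<in> segment \<Longrightarrow> y \<in> U \<Longrightarrow> \<rho> y < 0"
    and "D \<noteq> 0" "\<not> \<rho> x < 0"
    using ld fr(3) unfolding local_defining_def D_def by auto
  moreover have "C_k 1 1 U \<rho>"
    using ld unfolding local_defining_def by blast
  ultimately have "((\<lambda>t. \<rho> (x(0 := t))) has_real_derivative D) (at (x 0 + \<sigma> * 0))"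
    by (auto simp: D_def partial_deriv_def partially_differentiable_def DERIV_deriv_iff_field_differentiable)
  then have "((\<lambda>h. \<rho> (x(0 := x 0 + \<sigma> * h))) has_real_derivative D * \<sigma>) (at 0)"
    by (rule DERIV_chain2) (auto intro!: derivative_eq_intros)
  moreover have "\<not> 0 < D * \<sigma>"
  proof
    assume "0 < D * \<sigma>"
    then obtain d where d: "d > 0"
      "\<And>h. 0 < h \<Longrightarrow> h < d \<Longrightarrow> \<rho> (x(0 := x 0 + \<sigma> * 0)) < \<rho> (x(0 := x 0 + \<sigma> * h))"
      using DERIV_pos_inc_right[OF calculation] by auto
    have "\<forall>\<^sub>F t in nhds (x 0 + \<sigma> * 0). x(0 := t) \<in> U"
      using openin_line_neighbourhood[OF U] by simp
    moreover have "filterlim (\<lambda>h. x 0 + \<sigma> * h) (nhds (x 0 + \<sigma> * 0)) (at_right 0)"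
      by (intro tendsto_intros)
    ultimately have "\<forall>\<^sub>F h in at_right 0. x(0 := x 0 + \<sigma> * h) \<in> U"
      by (rule eventually_compose_filterlim)
    moreover have "\<forall>\<^sub>F h in at_right 0. h \<in> {0<..<min d pi}"
      unfolding eventually_at_right_field using d(1) by (intro exI[of _ "min d pi"]) auto
    ultimately have "\<forall>\<^sub>F h :: real in at_right 0. False"
    proof eventually_elim
      case (elim h)
      have "x(0 := x 0 + \<sigma> * h) \<in> segment"
        using inward[of h] elim by (simp add: update_Rn_1[OF fr(2)])
      then have "\<rho> (x(0 := x 0 + \<sigma> * h)) < 0" using neg elim by blast
      then show False using d(2)[of h] elim \<open>\<not> \<rho> x < 0\<close> by simp
    qed
    then show False by simp
  qed
  ultimately have "\<nu> 0 = - \<sigma>"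
    using \<nu>0 \<open>D \<noteq> 0\<close> unfolding D_def[symmetric] by (auto simp: \<sigma>_def split: if_splits)
  moreover have "\<nu> \<in> Rn 1" using \<nu> by (simp add: outward_normal_def)
  ultimately show ?thesis
    using Rn_1_eq_line_point[of \<nu>] by (auto simp: \<sigma>_def)
qed

text \<open>
  The endpoints \<open>0\<close> and \<open>pi\<close> are critical points of the cosine. Knowing that the normal points
  outwards matters: the difference quotient then uses only points of the segment, where \<open>g\<close> is
  given by the formula.
\<close>

lemma neumann_segment_cos:
  assumes g: "\<And>x. x \<in> Euclidean_space 1 closure_of segment \<Longrightarrow> g x = a * cos (x 0)"
  shows "neumann 1 segment g"
  unfolding neumann_def
proof (intro ballI allI impI)
  fix x \<nu> assume x: "x \<in> Euclidean_space 1 frontier_of segment" and \<nu>: "outward_normal 1 segment x \<nu>"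
  note fr = frontier_segment[OF x]
  define \<sigma> :: real where "\<sigma> = (if x 0 = 0 then 1 else - 1)"
  have "\<nu> = line_point (- \<sigma>)"
    using outward_normal_segment[OF x \<nu>] by (simp add: \<sigma>_def)
  then have step: "(\<lambda>j. x j - h * \<nu> j) = line_point (x 0 + \<sigma> * h)" for h
    using fr(2) by (auto simp: line_point_def topspace_Euclidean_space)
  have "((\<lambda>h. a * cos (x 0 + \<sigma> * h)) has_real_derivative 0) (at 0)"
    using fr(4) by (auto intro!: derivative_eq_intros)
  then have "((\<lambda>h. (a * cos (x 0 + \<sigma> * h) - a * cos (x 0)) / h) \<longlongrightarrow> 0) (at 0)"
    by (simp add: DERIV_def)
  then have "((\<lambda>h. (a * cos (x 0 + \<sigma> * h) - a * cos (x 0)) / h) \<longlongrightarrow> 0) (at_right 0)"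
    by (simp add: filterlim_at_split)
  then have "((\<lambda>h. - ((a * cos (x 0 + \<sigma> * h) - a * cos (x 0)) / h)) \<longlongrightarrow> - 0) (at_right 0)"
    by (rule tendsto_minus)
  moreover have "\<forall>\<^sub>F h in at_right 0. - ((a * cos (x 0 + \<sigma> * h) - a * cos (x 0)) / h)
      = (g x - g (\<lambda>j. x j - h * \<nu> j)) / h"
  proof -
    have "\<forall>\<^sub>F h :: real in at_right 0. h \<in> {0<..<pi}"
      unfolding eventually_at_right_field by (intro exI[of _ pi]) auto
    then show ?thesis
    proof eventually_elim
      case (elim h)
      then have "line_point (x 0 + \<sigma> * h) \<in> segment"
        using fr(4) by (auto simp: \<sigma>_def)
      then have "g (line_point (x 0 + \<sigma> * h)) = a * cos (x 0 + \<sigma> * h)"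
        using g segment_subset_closure by fastforce
      then show ?case
        unfolding step g[OF fr(1)] by (simp add: minus_divide_left)
    qed
  qed
  ultimately show "has_normal_deriv g 0 x \<nu>"
    unfolding has_normal_deriv_def using Lim_transform_eventually by fastforce
qed


section \<open>The cosine equilibria\<close>

definition cosine_profile :: "nat \<Rightarrow> real \<Rightarrow> (nat \<Rightarrow> real) \<Rightarrow> nat \<Rightarrow> real" where
  "cosine_profile n a = (\<lambda>x\<in>Euclidean_space 1 closure_of segment. \<lambda>i. if i < n then a * cos (x 0) else 0)"

lemma has_partial_deriv_coordinate:
  assumes "(\<phi> has_real_derivative D) (at (x 0))"
  shows "partial_deriv 0 (\<lambda>x. \<phi> (x 0)) x = D"
  using assms by (simp add: partial_deriv_def DERIV_imp_deriv)

text \<open>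
  All components agree, so the relaxation terms vanish, and the values stay in \<open>[-1, 1]\<close>, where
  \<open>bistable\<close> is the identity. What remains is the linear equation \<open>w'' + w = 0\<close>, which every multiple
  of the cosine solves.
\<close>

lemma cosine_profile_equilibrium:
  assumes a: "\<bar>a\<bar> \<le> 1"
  shows "cosine_profile n a \<in> rd_equilibria n 1 (\<lambda>_. 1) (reaction n) segment"
proof -
  let ?K = "Euclidean_space 1 closure_of segment"
  let ?u = "cosine_profile n a"
  have K: "?K \<subseteq> Rn 1" by (rule closure_of_subset_topspace)
  have u: "?u x i = a * cos (x 0)" if "x \<in> ?K" "i < n" for x i
    using that by (simp add: cosine_profile_def)
  have "?u \<in> ?K \<rightarrow>\<^sub>E Rn n"
    by (auto simp: cosine_profile_def topspace_Euclidean_space)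
  moreover have "C_k 1 2 segment (\<lambda>x. ?u x i) \<and> C1_closure 1 segment (\<lambda>x. ?u x i) \<and>
      (\<forall>x\<in>segment. 1 * laplacian 1 (\<lambda>x. ?u x i) x + reaction n i (?u x) = 0) \<and>
      neumann 1 segment (\<lambda>x. ?u x i)" if i: "i < n" for i
  proof (intro conjI ballI)
    have eq: "?u x i = a * cos (x 0)" if "x \<in> segment" for x
      using that segment_subset_closure u i by blast
    have d1: "partial_deriv 0 (\<lambda>x. ?u x i) x = - a * sin (x 0)" if "x \<in> segment" for x
    proof -
      have "partial_deriv 0 (\<lambda>x. ?u x i) x = partial_deriv 0 (\<lambda>x. a * cos (x 0)) x"
        using that eq by (intro partial_deriv_cong_open(1)[OF openin_segment]) auto
      also have "\<dots> = - a * sin (x 0)"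
        by (rule has_partial_deriv_coordinate) (auto intro!: derivative_eq_intros)
      finally show ?thesis .
    qed
    have Ck: "C_k 1 k segment (\<lambda>x. ?u x i)" if "k \<le> 2" for k
    proof -
      let ?\<phi> = "\<lambda>k. [cos, \<lambda>t. - sin t, \<lambda>t. - cos t] ! k :: real \<Rightarrow> real"
      have "C_k 1 k segment (\<lambda>x. a * ?\<phi> 0 (\<Sum>l<1. 1 * x l))"
      proof (rule C_k_ridge)
        show "segment \<subseteq> Rn 1" using openin_segment by (rule openin_subset)
        have k: "k = 0 \<or> k = 1 \<or> k = 2" using that by auto
        then show "continuous_on UNIV (?\<phi> k)" 
          by (auto intro!: continuous_intros)
        fix j and t :: real assume "j < k"
        then have "j = 0 \<or> j = 1" using k by auto
        then show "(?\<phi> j has_real_derivative ?\<phi> (Suc j) t) (at t)"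
          by (auto intro!: derivative_eq_intros)
      qed
      then have "C_k 1 k segment (\<lambda>x. a * cos (x 0))" by simp
      then show ?thesis
        using C_k_cong_open[OF openin_segment, of "\<lambda>x. ?u x i" "\<lambda>x. a * cos (x 0)" k] eq by blast
    qed
    show "C_k 1 2 segment (\<lambda>x. ?u x i)" by (rule Ck) simp
    show "C1_closure 1 segment (\<lambda>x. ?u x i)"
      unfolding C1_closure_def continuous_in_iff_continuous_on[OF K]
    proof (intro conjI allI impI)
      show "C_k 1 1 segment (\<lambda>x. ?u x i)" by (rule Ck) simp
      have "continuous_on ?K (\<lambda>x. a * cos (x 0))"
        by (intro continuous_intros continuous_on_coordinate)
      then show "continuous_on ?K (\<lambda>x. ?u x i)"
        by (rule continuous_on_eq) (use u i in simp)
      have "continuous_on ?K (\<lambda>x. - a * sin (x 0))"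
        by (intro continuous_intros continuous_on_coordinate)
      then show "\<exists>G. continuous_on ?K G \<and> (\<forall>x\<in>segment. G x = partial_deriv j (\<lambda>x. ?u x i) x)"
        if "j < 1" for j
        using d1 that by (intro exI[of _ "\<lambda>x. - a * sin (x 0)"]) auto
    qed
    show "neumann 1 segment (\<lambda>x. ?u x i)"
      using u i by (intro neumann_segment_cos) auto
    fix x assume x: "x \<in> segment"
    have "partial_deriv 0 (partial_deriv 0 (\<lambda>x. ?u x i)) x = partial_deriv 0 (\<lambda>x. - a * sin (x 0)) x"
      using x d1 by (intro partial_deriv_cong_open(1)[OF openin_segment]) auto
    also have "\<dots> = - a * cos (x 0)"
      by (rule has_partial_deriv_coordinate) (auto intro!: derivative_eq_intros)
    finally have lap: "laplacian 1 (\<lambda>x. ?u x i) x = - a * cos (x 0)"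
      by (simp add: laplacian_def)
    have "mean n (?u x) = a * cos (x 0)"
      using i x u segment_subset_closure by (intro mean_const) auto
    moreover have "\<bar>a * cos (x 0)\<bar> \<le> 1"
      using a abs_cos_le_one[of "x 0"] by (simp add: abs_mult mult_le_one)
    ultimately show "1 * laplacian 1 (\<lambda>x. ?u x i) x + reaction n i (?u x) = 0"
      using lap eq[OF x] by (simp add: reaction_def bistable_linear)
  qed
  ultimately show ?thesis by (auto simp: rd_equilibria_def)
qed

text \<open>
  The amplitude \<open>a\<close> is read off from the value at \<open>pi / 3\<close>, so distinct amplitudes give distinct
  equilibria.
\<close>

lemma nonhomogeneous_equilibria_eqpoll_reals:
  assumes n: "0 < n"
  shows "nonhomogeneous_equilibria n 1 (\<lambda>_. 1) (reaction n) segment \<approx> (UNIV :: real set)"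
proof (rule lepoll_antisym)
  let ?N = "nonhomogeneous_equilibria n 1 (\<lambda>_. 1) (reaction n) segment"
  have "?N \<lesssim> rd_equilibria n 1 (\<lambda>_. 1) (reaction n) segment"
    by (rule subset_imp_lepoll) (auto simp: nonhomogeneous_equilibria_def)
  also have "\<dots> \<lesssim> (UNIV :: real set)" by (rule rd_equilibria_lepoll_reals)
  finally show "?N \<lesssim> (UNIV :: real set)" .
  have val: "cosine_profile n a (line_point t) 0 = a * cos t" if "0 < t" "t < pi" for a t
  proof -
    have "line_point t \<in> Euclidean_space 1 closure_of segment"
      using that by (intro subsetD[OF segment_subset_closure]) simp
    then show ?thesis using n by (simp add: cosine_profile_def)
  qed
  have "cosine_profile n a \<in> ?N" if "a \<in> {0<..<1}" for a
  proof -
    have "\<not> cosine_profile n a constant_on (Euclidean_space 1 closure_of segment)"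
    proof
      assume "cosine_profile n a constant_on (Euclidean_space 1 closure_of segment)"
      then obtain c where c: "\<And>x. x \<in> Euclidean_space 1 closure_of segment \<Longrightarrow> cosine_profile n a x = c"
        unfolding constant_on_def by blast
      have "line_point (pi / 2) \<in> segment" "line_point (pi / 3) \<in> segment" by simp_all
      then have "cosine_profile n a (line_point (pi / 2)) = cosine_profile n a (line_point (pi / 3))"
        using c segment_subset_closure by (metis subsetD)
      then have "a * cos (pi / 2) = a * cos (pi / 3)"
        using val[of "pi / 2" a] val[of "pi / 3" a] by simp
      then show False using that by (simp add: cos_60)
    qed
    then show ?thesis
      using cosine_profile_equilibrium[of a n] that by (auto simp: nonhomogeneous_equilibria_def)
  qed
  moreover have "inj_on (cosine_profile n) {0<..<1}"
  proof (rule inj_onI)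
    fix a b assume eq: "cosine_profile n a = cosine_profile n b"
    have "a * cos (pi / 3) = b * cos (pi / 3)"
      using val[of "pi / 3" a] val[of "pi / 3" b] unfolding eq by auto
    then show "a = b" by (simp add: cos_60)
  qed
  ultimately have "{0<..<1 :: real} \<lesssim> ?N"
    unfolding lepoll_def by blast
  moreover have "(UNIV :: real set) \<approx> {0<..<1 :: real}"
    by (rule eqpoll_sym) (simp add: open_interval_eqpoll_reals)
  ultimately show "(UNIV :: real set) \<lesssim> ?N"
    by (rule lepoll_trans1[rotated])
qed

theorem theorem2:
  shows "\<exists>(n::nat) (m::nat) (d :: nat \<Rightarrow> real) (f :: nat \<Rightarrow> (nat \<Rightarrow> real) \<Rightarrow> real) (\<Omega> :: (nat \<Rightarrow> real) set).
    1 \<le> n \<and> 1 \<le> m \<and>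
    smooth_bounded_domain m \<Omega> \<and>
    (\<forall>i<n. d i > 0) \<and>
    (\<forall>i<n. C_k n 2 (Rn n) (f i)) \<and>
    (\<forall>u\<in>Rn n. \<forall>i<n. \<forall>j<n. i \<noteq> j \<longrightarrow> partial_deriv j (f i) u > 0) \<and>
    card (ode_equilibria n f) = 3 \<and>
    all_ode_solutions_converge_into n f (ode_equilibria n f) \<and>
    nonhomogeneous_equilibria n m d f \<Omega> \<approx> (UNIV :: real set)"
proof (intro exI conjI)
  (* with two components the cooperativity condition has content *)
  let ?n = "2 :: nat"
  show "1 \<le> ?n" "(1 :: nat) \<le> 1" by simp_all
  show "smooth_bounded_domain 1 segment" by (rule smooth_bounded_segment)
  show "\<forall>i<?n. 0 < (\<lambda>_. 1 :: real) i" by simp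
  show "\<forall>i<?n. C_k ?n 2 (Rn ?n) (reaction ?n i)" by (simp add: reaction_C2)
  show "\<forall>u\<in>Rn ?n. \<forall>i<?n. \<forall>j<?n. i \<noteq> j \<longrightarrow> partial_deriv j (reaction ?n i) u > 0"
    using reaction_partial_deriv_pos by blast
  show "card (ode_equilibria ?n (reaction ?n)) = 3" by (rule card_ode_equilibria_reaction) simp
  show "all_ode_solutions_converge_into ?n (reaction ?n) (ode_equilibria ?n (reaction ?n))"
    unfolding all_ode_solutions_converge_into_def
    using reaction_solution_exists[of ?n] reaction_solution_converges[of ?n] by simp
  show "nonhomogeneous_equilibria ?n 1 (\<lambda>_. 1) (reaction ?n) segment \<approx> (UNIV :: real set)"
    by (rule nonhomogeneous_equilibria_eqpoll_reals) simp
qed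

end
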